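(* Let $\mathcal{M}$ be a meridian surface in $\mathbb{R}^4$ of the general class, given by $z(u,v)=f(u)\,l(v)+g(u)\,e_4$, $u\in I$, $v\in J$, with spherical curve $c: l=l(v)$ on $S^2(1)$ and meridian curve $m: u\mapsto (f(u),g(u))$. Then $\mathcal{M}$ is a Chen surface if and only if the curve $c$ on $S^2(1)$ is a circle with constant spherical curvature $\kappa = \mathrm{const} = b$, $b>0$, and the meridian $m$ is determined by $\dot f = y(f)$, where $$y(t) = \frac{\pm 1}{2\,t^{\pm 1}} \sqrt{4\,t^{\pm 2} - a\left(t^{\pm 2} - \frac{b^2}{a}\right)^2}, \qquad a=\mathrm{const}\neq 0,$$ and $g(u)$ is defined by $\dot g(u)=\sqrt{1-\dot f^2(u)}$. Here the signs in the exponents $t^{\pm1}$, $t^{\pm2}$ are all the same choice of sign, and the sign of the leading factor $\pm 1$ is an independent choice.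
   Context: Setting. $\mathbb{R}^4$ is Euclidean 4-space with standard orthonormal frame $\{e_1,e_2,e_3,e_4\}$ and metric $\langle\cdot,\cdot\rangle$; $S^2(1)$ is the unit sphere centered at the origin in $\mathbb{R}^3=\mathrm{span}\{e_1,e_2,e_3\}$. Dots denote $d/du$ and primes on $l,t,n$ denote $d/dv$; $I,J\subset\mathbb{R}$ are intervals. Meridian surfaces. Let $f,g$ be smooth functions on $I$ with $\dot f^2+\dot g^2=1$ and $f\neq 0$, and let $c: l=l(v)$, $v\in J$, be a smooth curve on $S^2(1)$ parametrized by arc length. Put $t(v)=l'(v)$ and let $\{t(v),n(v),l(v)\}$ be the orthonormal moving frame of $c$ in $\mathbb{R}^3$, with Frenet formulas $l'=t$, $t'=\kappa n-l$, $n'=-\kappa t$, where $\kappa=\kappa(v)$ is the spherical curvature of $c$. The surface $\mathcal{M}: z(u,v)=f(u)\,l(v)+g(u)\,e_4$, $u\in I$, $v\in J$, is called a meridian surface; the curve $m: u\mapsto(f(u),g(u))$ is its meridian curve, with curvature $\kappa_m=\dot f\ddot g-\dot g\ddot f$. The conventions are: $\dot g>0$, so that $\dot g=\sqrt{1-\dot f^2}$ and $\kappa_m=-\ddot f/\sqrt{1-\dot f^2}$; the sign of $\kappa$ depends on the choice of sign of $n$ (orientation of $c$), and when $\kappa$ is nowhere zero this is chosen so that $\kappa>0$. The description of the meridian is local: the leading sign in $y$ may be chosen separately on subintervals of $I$ on which $\dot f$ has no zeros. General class. $\mathcal{M}$ is of the general class if $\kappa_m(u)\neq 0$ for all $u\in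 I$ and $\kappa(v)\neq 0$ for all $v\in J$. Chen surfaces. For a surface in $\mathbb{R}^4$ with second fundamental tensor $\sigma$, the mean curvature vector field is $H=\frac12\,\mathrm{tr}\,\sigma$, and $A_\xi$ denotes the shape operator with respect to a normal field $\xi$. If $H\ne0$ everywhere, let $\{\xi_1=H/\|H\|,\ \xi_2\}$ be an orthonormal frame of the normal space; the allied mean curvature vector field is $a(H)=\frac{\|H\|}{2}\,\mathrm{tr}(A_{\xi_1}A_{\xi_2})\,\xi_2$. The surface is called a Chen surface if $a(H)$ vanishes identically. (For a meridian surface of the general class, $H\neq0$ everywhere.) *)

theory Defs
  imports "HOL-Analysis.Analysis"
begin

text \<open>
  Derivatives on an interval are taken within the interval, so that open, half-open and closed
  intervals are all covered. They are only meaningful on intervals with nonempty interior.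
\<close>

definition nondegenerate_interval :: "real set \<Rightarrow> bool" where
  "nondegenerate_interval S \<longleftrightarrow> is_interval S \<and> interior S \<noteq> {}"

definition deriv_on :: "real set \<Rightarrow> (real \<Rightarrow> 'a::real_normed_vector) \<Rightarrow> real \<Rightarrow> 'a" where
  "deriv_on S h = (\<lambda>x. vector_derivative h (at x within S))"

definition smooth_on :: "real set \<Rightarrow> (real \<Rightarrow> 'a::real_normed_vector) \<Rightarrow> bool" where
  "smooth_on S h \<longleftrightarrow> (\<forall>k. (deriv_on S ^^ k) h differentiable_on S)"


subsection \<open>Parametrized surfaces in \<open>\<real>\<^sup>4\<close>\<close>

definition partial_u :: "real set \<Rightarrow> (real \<Rightarrow> real \<Rightarrow> real^4) \<Rightarrow> real \<Rightarrow> real \<Rightarrow> real^4" where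
  "partial_u I z = (\<lambda>u v. deriv_on I (\<lambda>s. z s v) u)"

definition partial_v :: "real set \<Rightarrow> (real \<Rightarrow> real \<Rightarrow> real^4) \<Rightarrow> real \<Rightarrow> real \<Rightarrow> real^4" where
  "partial_v J z = (\<lambda>u v. deriv_on J (\<lambda>s. z u s) v)"

definition tangent_space ::
  "real set \<Rightarrow> real set \<Rightarrow> (real \<Rightarrow> real \<Rightarrow> real^4) \<Rightarrow> real \<Rightarrow> real \<Rightarrow> (real^4) set" where
  "tangent_space I J z u v = span {partial_u I z u v, partial_v J z u v}"

definition normal_space ::
  "real set \<Rightarrow> real set \<Rightarrow> (real \<Rightarrow> real \<Rightarrow> real^4) \<Rightarrow> real \<Rightarrow> real \<Rightarrow> (real^4) set" where
  "normal_space I J z u v = orthogonal_comp (tangent_space I J z u v)"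

definition normal_part ::
  "real set \<Rightarrow> real set \<Rightarrow> (real \<Rightarrow> real \<Rightarrow> real^4) \<Rightarrow> real \<Rightarrow> real \<Rightarrow> real^4 \<Rightarrow> real^4" where
  "normal_part I J z u v w =
    (THE \<xi>. \<xi> \<in> normal_space I J z u v \<and> w - \<xi> \<in> tangent_space I J z u v)"

text \<open>Coordinates of a tangent vector in the basis \<open>z\<^sub>u, z\<^sub>v\<close>; unique where the surface is regular.\<close>

definition tangent_coords ::
  "real set \<Rightarrow> real set \<Rightarrow> (real \<Rightarrow> real \<Rightarrow> real^4) \<Rightarrow> real \<Rightarrow> real \<Rightarrow> real^4 \<Rightarrow> real \<times> real" where
  "tangent_coords I J z u v X =
    (THE c. X = fst c *\<^sub>R partial_u I z u v + snd c *\<^sub>R partial_v J z u v)"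

text \<open>
  The second fundamental tensor \<open>\<sigma>\<close>: the bilinear map on the tangent space whose values on the
  coordinate fields are the normal parts of the second partial derivatives of \<open>z\<close>.
\<close>

definition second_fundamental_tensor ::
  "real set \<Rightarrow> real set \<Rightarrow> (real \<Rightarrow> real \<Rightarrow> real^4) \<Rightarrow> real \<Rightarrow> real
    \<Rightarrow> real^4 \<Rightarrow> real^4 \<Rightarrow> real^4" where
  "second_fundamental_tensor I J z u v X Y =
    (let (x1, x2) = tangent_coords I J z u v X;
         (y1, y2) = tangent_coords I J z u v Y;
         N = normal_part I J z u v
     in (x1 * y1) *\<^sub>R N (partial_u I (partial_u I z) u v)
      + (x1 * y2) *\<^sub>R N (partial_u I (partial_v J z) u v)
      + (x2 * y1) *\<^sub>R N (partial_v J (partial_u I z) u v)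
      + (x2 * y2) *\<^sub>R N (partial_v J (partial_v J z) u v))"

text \<open>
  Traces over the tangent space are computed in the orthonormal frame that the Gram--Schmidt
  process produces from \<open>z\<^sub>u, z\<^sub>v\<close>; they do not depend on the choice of orthonormal frame.
\<close>

definition tangent_frame1 ::
  "real set \<Rightarrow> real set \<Rightarrow> (real \<Rightarrow> real \<Rightarrow> real^4) \<Rightarrow> real \<Rightarrow> real \<Rightarrow> real^4" where
  "tangent_frame1 I J z u v = sgn (partial_u I z u v)"

definition tangent_frame2 ::
  "real set \<Rightarrow> real set \<Rightarrow> (real \<Rightarrow> real \<Rightarrow> real^4) \<Rightarrow> real \<Rightarrow> real \<Rightarrow> real^4" where
  "tangent_frame2 I J z u v =
    (let X = tangent_frame1 I J z u v; w = partial_v J z u v in sgn (w - (w \<bullet> X) *\<^sub>R X))"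

definition mean_curvature_vector ::
  "real set \<Rightarrow> real set \<Rightarrow> (real \<Rightarrow> real \<Rightarrow> real^4) \<Rightarrow> real \<Rightarrow> real \<Rightarrow> real^4" where
  "mean_curvature_vector I J z u v =
    (let X = tangent_frame1 I J z u v; Y = tangent_frame2 I J z u v;
         \<sigma> = second_fundamental_tensor I J z u v
     in (1/2) *\<^sub>R (\<sigma> X X + \<sigma> Y Y))"

definition shape_operator ::
  "real set \<Rightarrow> real set \<Rightarrow> (real \<Rightarrow> real \<Rightarrow> real^4) \<Rightarrow> real \<Rightarrow> real
    \<Rightarrow> real^4 \<Rightarrow> real^4 \<Rightarrow> real^4" where
  "shape_operator I J z u v \<xi> X =
    (THE W. W \<in> tangent_space I J z u v \<and>
      (\<forall>Y \<in> tangent_space I J z u v. W \<bullet> Y = second_fundamental_tensor I J z u v X Y \<bullet> \<xi>))"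

definition tangent_trace ::
  "real set \<Rightarrow> real set \<Rightarrow> (real \<Rightarrow> real \<Rightarrow> real^4) \<Rightarrow> real \<Rightarrow> real
    \<Rightarrow> (real^4 \<Rightarrow> real^4) \<Rightarrow> real" where
  "tangent_trace I J z u v L =
    (let X = tangent_frame1 I J z u v; Y = tangent_frame2 I J z u v
     in L X \<bullet> X + L Y \<bullet> Y)"

text \<open>
  Where the surface is regular and \<open>H \<noteq> 0\<close>, the vector \<open>\<xi>\<^sub>2\<close> below is determined up to sign, and
  the allied mean curvature vector is invariant under \<open>\<xi>\<^sub>2 \<mapsto> - \<xi>\<^sub>2\<close>.
\<close>

definition allied_mean_curvature_vector ::
  "real set \<Rightarrow> real set \<Rightarrow> (real \<Rightarrow> real \<Rightarrow> real^4) \<Rightarrow> real \<Rightarrow> real \<Rightarrow> real^4" where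
  "allied_mean_curvature_vector I J z u v =
    (let H = mean_curvature_vector I J z u v;
         \<xi>1 = H /\<^sub>R norm H;
         \<xi>2 = (SOME \<xi>. \<xi> \<in> normal_space I J z u v \<and> norm \<xi> = 1 \<and> orthogonal \<xi> \<xi>1);
         A = shape_operator I J z u v
     in (norm H / 2 * tangent_trace I J z u v (A \<xi>1 \<circ> A \<xi>2)) *\<^sub>R \<xi>2)"

definition Chen_surface ::
  "real set \<Rightarrow> real set \<Rightarrow> (real \<Rightarrow> real \<Rightarrow> real^4) \<Rightarrow> bool" where
  "Chen_surface I J z \<longleftrightarrow>
    (\<forall>u \<in> I. \<forall>v \<in> J. mean_curvature_vector I J z u v \<noteq> 0) \<and>
    (\<forall>u \<in> I. \<forall>v \<in> J. allied_mean_curvature_vector I J z u v = 0)"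


subsection \<open>Curves on the unit sphere of \<open>\<real>\<^sup>3 = span {e\<^sub>1, e\<^sub>2, e\<^sub>3}\<close>\<close>

definition R3 :: "(real^4) set" where
  "R3 = span {axis 1 1, axis 2 1, axis 3 1}"

definition S2 :: "(real^4) set" where
  "S2 = sphere 0 1 \<inter> R3"

definition arclength_spherical_curve :: "real set \<Rightarrow> (real \<Rightarrow> real^4) \<Rightarrow> bool" where
  "arclength_spherical_curve J l \<longleftrightarrow>
    smooth_on J l \<and> (\<forall>v \<in> J. l v \<in> S2 \<and> norm (deriv_on J l v) = 1)"

text \<open>
  A field \<open>n\<close> completing \<open>l\<close> and \<open>t = l'\<close> to a smooth orthonormal frame of \<open>\<real>\<^sup>3\<close> along the curve; it
  is determined by \<open>l\<close> up to sign. The remaining orthonormality relations hold automatically.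
\<close>

definition spherical_normal :: "real set \<Rightarrow> (real \<Rightarrow> real^4) \<Rightarrow> (real \<Rightarrow> real^4) \<Rightarrow> bool" where
  "spherical_normal J l n \<longleftrightarrow>
    smooth_on J n \<and>
    (\<forall>v \<in> J. n v \<in> R3 \<and> norm (n v) = 1 \<and>
      orthogonal (n v) (l v) \<and> orthogonal (n v) (deriv_on J l v))"

text \<open>The coefficient \<open>\<kappa>\<close> of the Frenet formulas \<open>t' = \<kappa> n - l\<close>, \<open>n' = - \<kappa> t\<close>.\<close>

definition spherical_curvature ::
  "real set \<Rightarrow> (real \<Rightarrow> real^4) \<Rightarrow> (real \<Rightarrow> real^4) \<Rightarrow> real \<Rightarrow> real" where
  "spherical_curvature J l n v = deriv_on J (deriv_on J l) v \<bullet> n v"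

definition circle_on_S2 :: "(real^4) set \<Rightarrow> bool" where
  "circle_on_S2 C \<longleftrightarrow>
    (\<exists>m \<in> S2. \<exists>d. \<bar>d\<bar> < 1 \<and> C = {x \<in> S2. m \<bullet> x = d})"


subsection \<open>Meridian surfaces\<close>

definition meridian_curve :: "real set \<Rightarrow> (real \<Rightarrow> real) \<Rightarrow> (real \<Rightarrow> real) \<Rightarrow> bool" where
  "meridian_curve I f g \<longleftrightarrow>
    smooth_on I f \<and> smooth_on I g \<and>
    (\<forall>u \<in> I. f u \<noteq> 0 \<and> (deriv_on I f u)\<^sup>2 + (deriv_on I g u)\<^sup>2 = 1 \<and> deriv_on I g u > 0)"

definition meridian_curvature ::
  "real set \<Rightarrow> (real \<Rightarrow> real) \<Rightarrow> (real \<Rightarrow> real) \<Rightarrow> real \<Rightarrow> real" where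
  "meridian_curvature I f g u =
    deriv_on I f u * deriv_on I (deriv_on I g) u - deriv_on I g u * deriv_on I (deriv_on I f) u"

definition meridian_surface ::
  "(real \<Rightarrow> real) \<Rightarrow> (real \<Rightarrow> real) \<Rightarrow> (real \<Rightarrow> real^4) \<Rightarrow> real \<Rightarrow> real \<Rightarrow> real^4" where
  "meridian_surface f g l = (\<lambda>u v. f u *\<^sub>R l v + g u *\<^sub>R axis 4 1)"

definition general_class ::
  "real set \<Rightarrow> real set \<Rightarrow> (real \<Rightarrow> real) \<Rightarrow> (real \<Rightarrow> real)
    \<Rightarrow> (real \<Rightarrow> real^4) \<Rightarrow> (real \<Rightarrow> real^4) \<Rightarrow> bool" where
  "general_class I J f g l n \<longleftrightarrow>
    (\<forall>u \<in> I. meridian_curvature I f g u \<noteq> 0) \<and> (\<forall>v \<in> J. spherical_curvature J l n v \<noteq> 0)"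

text \<open>
  In the following two definitions \<open>s \<in> {1, -1}\<close> is the common sign of the exponents and
  \<open>\<epsilon> \<in> {1, -1}\<close> the leading sign. Since \<open>sqrt\<close> is total, with \<open>sqrt (- x) = - sqrt x\<close>, a statement
  about \<open>chen_y\<close> has to require the radicand to be nonnegative.
\<close>

definition chen_radicand :: "int \<Rightarrow> real \<Rightarrow> real \<Rightarrow> real \<Rightarrow> real" where
  "chen_radicand s a b t = 4 * t powi (2 * s) - a * (t powi (2 * s) - b\<^sup>2 / a)\<^sup>2"

definition chen_y :: "real \<Rightarrow> int \<Rightarrow> real \<Rightarrow> real \<Rightarrow> real \<Rightarrow> real" where
  "chen_y \<epsilon> s a b t = \<epsilon> / (2 * t powi s) * sqrt (chen_radicand s a b t)"

text \<open>
  The meridian is determined by \<open>f' = y(f)\<close> and \<open>g' = sqrt (1 - f'\<^sup>2)\<close>. The constant \<open>a\<close> and the sign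
  \<open>s\<close> are the same on all of \<open>I\<close>, whereas the leading sign may differ between subintervals of \<open>I\<close>
  on which \<open>f'\<close> has no zeros.
\<close>

definition meridian_determined_by_y ::
  "real set \<Rightarrow> (real \<Rightarrow> real) \<Rightarrow> (real \<Rightarrow> real) \<Rightarrow> int \<Rightarrow> real \<Rightarrow> real \<Rightarrow> bool" where
  "meridian_determined_by_y I f g s a b \<longleftrightarrow>
    (\<exists>\<epsilon> :: real \<Rightarrow> real.
      (\<forall>u \<in> I. \<epsilon> u \<in> {1, -1}) \<and>
      (\<forall>K \<subseteq> I. is_interval K \<and> (\<forall>u \<in> K. deriv_on I f u \<noteq> 0) \<longrightarrow> \<epsilon> constant_on K) \<and>
      (\<forall>u \<in> I. chen_radicand s a b (f u) \<ge> 0 \<and> deriv_on I f u = chen_y (\<epsilon> u) s a b (f u))) \<and>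
    (\<forall>u \<in> I. deriv_on I g u = sqrt (1 - (deriv_on I f u)\<^sup>2))"

end

theory Submission
  imports Defs
begin

text \<open>
  In the orthonormal frame \<open>f' l + g' e\<^sub>4\<close>, \<open>t\<close> of the tangent space and \<open>n\<close>,
  \<open>n\<^sub>2 = - g' l + f' e\<^sub>4\<close> of the normal space, the second fundamental tensor is diagonal, with
  entries \<open>\<kappa>\<^sub>m n\<^sub>2\<close> and \<open>(\<kappa> / f) n + (g' / f) n\<^sub>2\<close>. Up to a factor without zeros, the allied mean
  curvature is \<open>(f \<kappa>\<^sub>m)\<^sup>2 - \<kappa>\<^sup>2 - g'\<^sup>2\<close>. If it vanishes, separation of variables makes \<open>\<kappa>\<close> a
  constant \<open>b\<close>, so that \<open>n + b l\<close> is constant and is the axis of a circle containing the curve.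

  What remains is the equation \<open>(f \<kappa>\<^sub>m)\<^sup>2 = b\<^sup>2 + g'\<^sup>2\<close>. Here \<open>f \<kappa>\<^sub>m = s sqrt (b\<^sup>2 + g'\<^sup>2)\<close> with a
  constant sign \<open>s\<close>, and \<open>Q = g' + sqrt (b\<^sup>2 + g'\<^sup>2)\<close> satisfies \<open>Q' / Q = s f' / f\<close>. Hence \<open>Q = k f\<^sup>s\<close>,
  and \<open>2 g' = Q - b\<^sup>2 / Q\<close> gives the formula for \<open>f'\<^sup>2 = 1 - g'\<^sup>2\<close> with \<open>a = k\<^sup>2\<close>. Conversely, the formula
  for \<open>g'\<^sup>2\<close> can be differentiated and divided by \<open>f'\<close>; zeros of \<open>f'\<close> are isolated because
  \<open>\<kappa>\<^sub>m \<noteq> 0\<close>, so continuity settles them.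
\<close>

subsection \<open>Derivatives within an interval and orthonormal frames\<close>

text \<open>A connected set with more than one point has no isolated points. The nontrivial filter
  is what makes the derivative within the interval unique, also at an endpoint.\<close>

lemma nondegenerate_interval_at_within:
  assumes "nondegenerate_interval S" "x \<in> S"
  shows "at x within S \<noteq> bot"
proof -
  have "connected S" "interior S \<noteq> {}"
    using assms(1) by (auto simp: nondegenerate_interval_def is_interval_connected)
  moreover have "S \<noteq> {y}" for y
    using \<open>interior S \<noteq> {}\<close> by auto
  ultimately show ?thesis
    using connected_imp_perfect[of S x] assms(2) by (simp add: trivial_limit_within)
qed

lemma deriv_on_eq:
  assumes "nondegenerate_interval S" "x \<in> S" "(h has_vector_derivative d) (at x within S)"
  shows "deriv_on S h x = d"
  unfolding deriv_on_def
  using assms nondegenerate_interval_at_within vector_derivative_within by blast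

lemma deriv_on_cong:
  assumes "x \<in> S" "\<And>y. y \<in> S \<Longrightarrow> h y = k y"
  shows "deriv_on S h x = deriv_on S k x"
  unfolding deriv_on_def
  by (rule vector_derivative_cong_eq) (use assms in auto)

lemma smooth_on_has_vector_derivative:
  assumes "smooth_on S h" "x \<in> S"
  shows "(h has_vector_derivative deriv_on S h x) (at x within S)"
proof -
  have "h differentiable_on S"
    using assms(1) unfolding smooth_on_def by (metis funpow_0)
  then show ?thesis
    unfolding deriv_on_def
    using assms(2) by (simp add: differentiable_on_def vector_derivative_works[symmetric])
qed

lemma smooth_on_deriv_on:
  assumes "smooth_on S h"
  shows "smooth_on S (deriv_on S h)"
  unfolding smooth_on_def
proof
  fix k
  show "(deriv_on S ^^ k) (deriv_on S h) differentiable_on S"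
    using assms unfolding smooth_on_def by (metis funpow_Suc_right o_apply)
qed

lemma smooth_on_continuous_on:
  assumes "smooth_on S h"
  shows "continuous_on S h"
  using smooth_on_has_vector_derivative[OF assms]
  by (meson continuous_on_eq_continuous_within has_vector_derivative_continuous)

text \<open>This is the product rule. Applied to the orthonormality relations of the moving frame,
  it yields all components of \<open>t'\<close> and \<open>n'\<close> that the Frenet formulas
  need.\<close>

lemma inner_const_imp_derivs:
  fixes h k :: "real \<Rightarrow> 'a::real_inner"
  assumes "nondegenerate_interval S" "x \<in> S"
    and "(h has_vector_derivative h') (at x within S)"
    and "(k has_vector_derivative k') (at x within S)"
    and "\<And>y. y \<in> S \<Longrightarrow> h y \<bullet> k y = c"
  shows "h x \<bullet> k' + h' \<bullet> k x = 0"
proof -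
  have "((\<lambda>y. h y \<bullet> k y) has_vector_derivative h x \<bullet> k' + h' \<bullet> k x) (at x within S)"
    by (rule bounded_bilinear.has_vector_derivative[OF bounded_bilinear_inner assms(3,4)])
  then have "deriv_on S (\<lambda>y. h y \<bullet> k y) x = h x \<bullet> k' + h' \<bullet> k x"
    using assms(1,2) by (rule deriv_on_eq[rotated 2])
  moreover have "deriv_on S (\<lambda>y. h y \<bullet> k y) x = deriv_on S (\<lambda>y. c) x"
    by (rule deriv_on_cong) (use assms in auto)
  moreover have "deriv_on S (\<lambda>y. c) x = 0"
    by (rule deriv_on_eq) (use assms in \<open>auto intro: derivative_intros\<close>)
  ultimately show ?thesis by simp
qed

section \<open>Orthonormal frames of Euclidean 4-space\<close>

definition orthonormal_frame :: "real^4 \<Rightarrow> real^4 \<Rightarrow> real^4 \<Rightarrow> real^4 \<Rightarrow> bool" where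
  "orthonormal_frame e1 e2 e3 e4 \<longleftrightarrow>
    e1 \<bullet> e1 = 1 \<and> e2 \<bullet> e2 = 1 \<and> e3 \<bullet> e3 = 1 \<and> e4 \<bullet> e4 = 1 \<and>
    e1 \<bullet> e2 = 0 \<and> e1 \<bullet> e3 = 0 \<and> e1 \<bullet> e4 = 0 \<and>
    e2 \<bullet> e3 = 0 \<and> e2 \<bullet> e4 = 0 \<and> e3 \<bullet> e4 = 0"

text \<open>Four orthonormal vectors are independent, so by dimension they span the whole space and
  the Fourier expansion applies.\<close>

lemma orthonormal_frame_expand:
  assumes "orthonormal_frame e1 e2 e3 e4"
  shows "x = (x \<bullet> e1) *\<^sub>R e1 + (x \<bullet> e2) *\<^sub>R e2 + (x \<bullet> e3) *\<^sub>R e3 + (x \<bullet> e4) *\<^sub>R e4"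
proof -
  let ?B = "{e1, e2, e3, e4}"
  note o = assms[unfolded orthonormal_frame_def]
  have ne: "e1 \<noteq> e2" "e1 \<noteq> e3" "e1 \<noteq> e4" "e2 \<noteq> e3" "e2 \<noteq> e4" "e3 \<noteq> e4"
    using o by auto
  have orth: "pairwise orthogonal ?B"
    using o by (auto simp: pairwise_def orthogonal_def inner_commute)
  have "0 \<notin> ?B" using o by auto
  then have ind: "independent ?B"
    by (rule pairwise_orthogonal_independent[OF orth])
  have "card ?B = DIM(real^4)" using ne by simp
  then have "span ?B = UNIV"
    using ind by (metis dim_UNIV card_ge_dim_independent
        subset_UNIV order_refl top.extremum_uniqueI)
  then have "(\<Sum>i\<in>?B. (x \<bullet> i) *\<^sub>R i) = x"
    using o by (intro orthonormal_basis_expand orth) (auto simp: norm_eq_sqrt_inner)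
  then show ?thesis using ne by (simp add: add.assoc)
qed

lemma orthonormal_frame_eqI:
  assumes "orthonormal_frame e1 e2 e3 e4"
    and "x \<bullet> e1 = y \<bullet> e1" "x \<bullet> e2 = y \<bullet> e2" "x \<bullet> e3 = y \<bullet> e3" "x \<bullet> e4 = y \<bullet> e4"
  shows "x = y"
  using orthonormal_frame_expand[OF assms(1), of x] orthonormal_frame_expand[OF assms(1), of y]
    assms(2-) by simp

subsection \<open>The allied mean curvature vector in a principal frame\<close>

lemma normal_space_iff:
  "\<xi> \<in> normal_space I J z u v \<longleftrightarrow>
    \<xi> \<bullet> partial_u I z u v = 0 \<and> \<xi> \<bullet> partial_v J z u v = 0"
proof
  assume "\<xi> \<in> normal_space I J z u v"
  then show "\<xi> \<bullet> partial_u I z u v = 0 \<and> \<xi> \<bullet> partial_v J z u v = 0"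
    by (auto simp: normal_space_def tangent_space_def orthogonal_comp_def orthogonal_def
        span_base inner_commute)
next
  assume a: "\<xi> \<bullet> partial_u I z u v = 0 \<and> \<xi> \<bullet> partial_v J z u v = 0"
  have "orthogonal \<xi> y" if "y \<in> span {partial_u I z u v, partial_v J z u v}" for y
    by (rule orthogonal_to_span[OF that]) (use a in \<open>auto simp: orthogonal_def\<close>)
  then show "\<xi> \<in> normal_space I J z u v"
    by (auto simp: normal_space_def tangent_space_def orthogonal_comp_def orthogonal_commute)
qed

lemma normal_part_eq:
  assumes "\<xi> \<in> normal_space I J z u v" "w - \<xi> \<in> tangent_space I J z u v"
  shows "normal_part I J z u v w = \<xi>"
  unfolding normal_part_def
proof (rule the_equality)
  show "\<xi> \<in> normal_space I J z u v \<and> w - \<xi> \<in> tangent_space I J z u v"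
    using assms by blast
  fix \<eta> assume \<eta>: "\<eta> \<in> normal_space I J z u v \<and> w - \<eta> \<in> tangent_space I J z u v"
  have "(w - \<xi>) - (w - \<eta>) \<in> tangent_space I J z u v"
    using assms(2) \<eta> unfolding tangent_space_def by (blast intro: span_diff)
  then have "\<eta> - \<xi> \<in> tangent_space I J z u v" by simp
  moreover have "\<eta> - \<xi> \<in> normal_space I J z u v"
    using assms(1) \<eta> by (simp add: normal_space_iff inner_diff_left)
  ultimately have "orthogonal (\<eta> - \<xi>) (\<eta> - \<xi>)"
    by (auto simp: normal_space_def orthogonal_comp_def)
  then show "\<eta> = \<xi>" by (simp add: orthogonal_def)
qed

text \<open>A point at which \<open>z_u\<close> is a unit vector, \<open>z_v\<close> is
  perpendicular to it, and the second fundamental tensor is diagonal in these directions: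
  \<open>q\<close> and \<open>(p, r)\<close> are the coordinates of its two diagonal values with
  respect to \<open>n1\<close>, \<open>n2\<close>. The squared norm in \<open>N_vv\<close> appears
  because \<open>z_v\<close> itself need not have unit length.\<close>

locale orthogonal_net_point =
  fixes I J :: "real set" and z :: "real \<Rightarrow> real \<Rightarrow> real^4" and u v :: real
    and n1 n2 :: "real^4" and p q r :: real
  assumes frame: "orthonormal_frame (partial_u I z u v) (sgn (partial_v J z u v)) n1 n2"
    and N_uu: "normal_part I J z u v (partial_u I (partial_u I z) u v) = q *\<^sub>R n2"
    and N_uv: "normal_part I J z u v (partial_u I (partial_v J z) u v) = 0"
    and N_vu: "normal_part I J z u v (partial_v J (partial_u I z) u v) = 0"
    and N_vv: "normal_part I J z u v (partial_v J (partial_v J z) u v) =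
      (norm (partial_v J z u v))\<^sup>2 *\<^sub>R (p *\<^sub>R n1 + r *\<^sub>R n2)"
begin

abbreviation X :: "real^4" where "X \<equiv> partial_u I z u v"
abbreviation Y :: "real^4" where "Y \<equiv> sgn (partial_v J z u v)"
abbreviation \<sigma> :: "real^4 \<Rightarrow> real^4 \<Rightarrow> real^4" where
  "\<sigma> \<equiv> second_fundamental_tensor I J z u v"

lemma inner_frame:
  "X \<bullet> X = 1" "Y \<bullet> Y = 1" "n1 \<bullet> n1 = 1" "n2 \<bullet> n2 = 1"
  "X \<bullet> Y = 0" "X \<bullet> n1 = 0" "X \<bullet> n2 = 0" "Y \<bullet> n1 = 0" "Y \<bullet> n2 = 0" "n1 \<bullet> n2 = 0"
  "Y \<bullet> X = 0" "n1 \<bullet> X = 0" "n2 \<bullet> X = 0" "n1 \<bullet> Y = 0" "n2 \<bullet> Y = 0" "n2 \<bullet> n1 = 0"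
  using frame by (auto simp: orthonormal_frame_def inner_commute)

lemma partial_v_eq: "partial_v J z u v = norm (partial_v J z u v) *\<^sub>R Y"
  by (cases "partial_v J z u v = 0") (simp_all add: sgn_div_norm)

lemma norm_partial_v: "norm (partial_v J z u v) \<noteq> 0"
  using inner_frame(2) by auto

lemma tangent_space_iff:
  "x \<in> tangent_space I J z u v \<longleftrightarrow> (\<exists>\<alpha> \<beta>. x = \<alpha> *\<^sub>R X + \<beta> *\<^sub>R Y)"
proof
  assume "x \<in> tangent_space I J z u v"
  then obtain \<alpha> \<gamma> where "x = \<alpha> *\<^sub>R X + \<gamma> *\<^sub>R partial_v J z u v"
    unfolding tangent_space_def span_insert by (auto simp: algebra_simps)
  then have "x = \<alpha> *\<^sub>R X + (\<gamma> * norm (partial_v J z u v)) *\<^sub>R Y"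
    by (metis partial_v_eq scaleR_scaleR)
  then show "\<exists>\<alpha> \<beta>. x = \<alpha> *\<^sub>R X + \<beta> *\<^sub>R Y" by blast
next
  assume "\<exists>\<alpha> \<beta>. x = \<alpha> *\<^sub>R X + \<beta> *\<^sub>R Y"
  then show "x \<in> tangent_space I J z u v"
    unfolding tangent_space_def sgn_div_norm
    by (blast intro: span_add span_mul span_base)
qed

lemma tangent_coords_eq:
  "tangent_coords I J z u v (\<alpha> *\<^sub>R X + \<beta> *\<^sub>R Y) = (\<alpha>, \<beta> / norm (partial_v J z u v))"
  unfolding tangent_coords_def
proof (rule the_equality)
  show "\<alpha> *\<^sub>R X + \<beta> *\<^sub>R Y =
      fst (\<alpha>, \<beta> / norm (partial_v J z u v)) *\<^sub>R X
      + snd (\<alpha>, \<beta> / norm (partial_v J z u v)) *\<^sub>R partial_v J z u v"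
    by (simp add: sgn_div_norm divide_inverse)
  fix c assume "\<alpha> *\<^sub>R X + \<beta> *\<^sub>R Y = fst c *\<^sub>R X + snd c *\<^sub>R partial_v J z u v"
  then have eq: "\<alpha> *\<^sub>R X + \<beta> *\<^sub>R Y = fst c *\<^sub>R X + (snd c * norm (partial_v J z u v)) *\<^sub>R Y"
    by (metis partial_v_eq scaleR_scaleR)
  have "\<alpha> = fst c" "\<beta> = snd c * norm (partial_v J z u v)"
    using arg_cong[OF eq, of "\<lambda>x. x \<bullet> X"] arg_cong[OF eq, of "\<lambda>x. x \<bullet> Y"]
    by (simp_all only: inner_add_left inner_scaleR_left inner_frame mult_zero_right mult_1_right
        add_0_left add_0_right)
  then show "c = (\<alpha>, \<beta> / norm (partial_v J z u v))"
    using norm_partial_v by (simp add: prod_eq_iff)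
qed

text \<open>The mixed terms vanish by \<open>N_uv\<close> and \<open>N_vu\<close>. The two factors
  \<open>1 / norm z_v\<close> from the tangent coordinates cancel the squared norm in
  \<open>N_vv\<close>.\<close>

lemma \<sigma>_eq:
  "\<sigma> (\<alpha> *\<^sub>R X + \<beta> *\<^sub>R Y) (\<gamma> *\<^sub>R X + \<delta> *\<^sub>R Y) =
    (\<alpha> * \<gamma> * q) *\<^sub>R n2 + (\<beta> * \<delta>) *\<^sub>R (p *\<^sub>R n1 + r *\<^sub>R n2)"
  using norm_partial_v
  by (simp add: second_fundamental_tensor_def tangent_coords_eq N_uu N_uv N_vu N_vv power2_eq_square)

text \<open>Since \<open>z_u\<close> is already a unit vector and \<open>z_v\<close> is
  perpendicular to it, Gram-Schmidt only normalizes \<open>z_v\<close>.\<close>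

lemma tangent_frame_eq:
  "tangent_frame1 I J z u v = X" "tangent_frame2 I J z u v = Y"
proof -
  have "norm X = 1" using inner_frame(1) by (simp add: norm_eq_sqrt_inner)
  then show 1: "tangent_frame1 I J z u v = X" by (simp add: tangent_frame1_def sgn_div_norm)
  have "partial_v J z u v \<bullet> X = 0"
    by (subst partial_v_eq) (simp only: inner_scaleR_left inner_frame mult_zero_right)
  then show "tangent_frame2 I J z u v = Y" by (simp add: tangent_frame2_def 1 Let_def)
qed

lemma \<sigma>_frame: "\<sigma> X X = q *\<^sub>R n2" "\<sigma> Y Y = p *\<^sub>R n1 + r *\<^sub>R n2"
  using \<sigma>_eq[of 1 0 1 0] \<sigma>_eq[of 0 1 0 1] by simp_all

lemma mean_curvature_vector_eq:
  "mean_curvature_vector I J z u v = (1/2) *\<^sub>R (p *\<^sub>R n1 + (q + r) *\<^sub>R n2)"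
  by (simp add: mean_curvature_vector_def tangent_frame_eq Let_def \<sigma>_frame algebra_simps)

text \<open>The tensor is diagonal in the frame \<open>X\<close>, \<open>Y\<close>, hence so is
  every shape operator; inner products with \<open>X\<close> and \<open>Y\<close> give
  uniqueness.\<close>

lemma shape_operator_eq:
  "shape_operator I J z u v \<xi> (\<alpha> *\<^sub>R X + \<beta> *\<^sub>R Y) =
    (\<alpha> * (\<sigma> X X \<bullet> \<xi>)) *\<^sub>R X + (\<beta> * (\<sigma> Y Y \<bullet> \<xi>)) *\<^sub>R Y"
  unfolding shape_operator_def
proof (rule the_equality)
  let ?W = "(\<alpha> * (\<sigma> X X \<bullet> \<xi>)) *\<^sub>R X + (\<beta> * (\<sigma> Y Y \<bullet> \<xi>)) *\<^sub>R Y"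
  have W: "?W \<bullet> (\<gamma> *\<^sub>R X + \<delta> *\<^sub>R Y) = \<sigma> (\<alpha> *\<^sub>R X + \<beta> *\<^sub>R Y) (\<gamma> *\<^sub>R X + \<delta> *\<^sub>R Y) \<bullet> \<xi>" for \<gamma> \<delta>
    unfolding \<sigma>_frame
    by (simp only: \<sigma>_eq inner_add_left inner_add_right inner_scaleR_left inner_scaleR_right
        inner_frame) (simp add: algebra_simps)
  then show "?W \<in> tangent_space I J z u v \<and> (\<forall>Z \<in> tangent_space I J z u v.
      ?W \<bullet> Z = \<sigma> (\<alpha> *\<^sub>R X + \<beta> *\<^sub>R Y) Z \<bullet> \<xi>)"
    by (metis tangent_space_iff)
  fix V assume V: "V \<in> tangent_space I J z u v \<and> (\<forall>Z \<in> tangent_space I J z u v.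
      V \<bullet> Z = \<sigma> (\<alpha> *\<^sub>R X + \<beta> *\<^sub>R Y) Z \<bullet> \<xi>)"
  have "V \<bullet> (\<gamma> *\<^sub>R X + \<delta> *\<^sub>R Y) = ?W \<bullet> (\<gamma> *\<^sub>R X + \<delta> *\<^sub>R Y)" for \<gamma> \<delta>
    using V W tangent_space_iff by metis
  from this[of 1 0] this[of 0 1] have "V \<bullet> X = ?W \<bullet> X" "V \<bullet> Y = ?W \<bullet> Y" by simp_all
  moreover obtain \<gamma> \<delta> where "V = \<gamma> *\<^sub>R X + \<delta> *\<^sub>R Y" using V tangent_space_iff by blast
  ultimately have "\<gamma> = \<alpha> * (\<sigma> X X \<bullet> \<xi>)" "\<delta> = \<beta> * (\<sigma> Y Y \<bullet> \<xi>)"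
    by (simp_all only: inner_add_left inner_scaleR_left inner_frame mult_zero_right mult_1_right
        add_0_left add_0_right)
  with \<open>V = _\<close> show "V = ?W" by simp
qed

lemma tangent_trace_shape_operators:
  "tangent_trace I J z u v (shape_operator I J z u v \<xi> \<circ> shape_operator I J z u v \<eta>) =
    (\<sigma> X X \<bullet> \<xi>) * (\<sigma> X X \<bullet> \<eta>) + (\<sigma> Y Y \<bullet> \<xi>) * (\<sigma> Y Y \<bullet> \<eta>)"
proof -
  let ?A = "shape_operator I J z u v"
  have "?A \<eta> X = (\<sigma> X X \<bullet> \<eta>) *\<^sub>R X + 0 *\<^sub>R Y" "?A \<eta> Y = 0 *\<^sub>R X + (\<sigma> Y Y \<bullet> \<eta>) *\<^sub>R Y"
    using shape_operator_eq[of \<eta> 1 0] shape_operator_eq[of \<eta> 0 1] by simp_all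
  then have "?A \<xi> (?A \<eta> X) = ((\<sigma> X X \<bullet> \<eta>) * (\<sigma> X X \<bullet> \<xi>)) *\<^sub>R X"
    "?A \<xi> (?A \<eta> Y) = ((\<sigma> Y Y \<bullet> \<eta>) * (\<sigma> Y Y \<bullet> \<xi>)) *\<^sub>R Y"
    by (simp_all only: shape_operator_eq) simp_all
  then show ?thesis
    unfolding tangent_trace_def tangent_frame_eq Let_def o_def
    by (simp only: inner_scaleR_left inner_frame) simp
qed

lemma mean_curvature_vector_nonzero:
  assumes "p \<noteq> 0"
  shows "mean_curvature_vector I J z u v \<noteq> 0"
proof
  assume "mean_curvature_vector I J z u v = 0"
  then have "mean_curvature_vector I J z u v \<bullet> n1 = 0" by simp
  then show False using assms by (simp add: mean_curvature_vector_eq inner_add_left inner_frame)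
qed

text \<open>The chosen \<xi>2 is known only through being a unit normal perpendicular to
  \<open>H\<close>. This fixes the ratio of its coordinates \<alpha>, \<beta>, and the trace becomes
  \<open>\<beta> * q * (q\<^sup>2 - p\<^sup>2 - r\<^sup>2)\<close> divided by
  \<open>2 * norm H\<close>.\<close>

lemma allied_mean_curvature_vector_eq_0_iff:
  assumes "p \<noteq> 0" "q \<noteq> 0"
  shows "allied_mean_curvature_vector I J z u v = 0 \<longleftrightarrow> q\<^sup>2 = p\<^sup>2 + r\<^sup>2"
proof -
  define H where "H = mean_curvature_vector I J z u v"
  have H: "H \<noteq> 0" "H = (1/2) *\<^sub>R (p *\<^sub>R n1 + (q + r) *\<^sub>R n2)"
    unfolding H_def using mean_curvature_vector_nonzero assms mean_curvature_vector_eq by auto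
  define \<xi>1 where "\<xi>1 = H /\<^sub>R norm H"
  define P where "P \<xi> \<longleftrightarrow> \<xi> \<in> normal_space I J z u v \<and> norm \<xi> = 1 \<and> orthogonal \<xi> \<xi>1" for \<xi>
  define \<xi>2 where "\<xi>2 = (SOME \<xi>. P \<xi>)"
  have normal: "\<alpha> *\<^sub>R n1 + \<beta> *\<^sub>R n2 \<in> normal_space I J z u v" for \<alpha> \<beta>
  proof -
    have "(\<alpha> *\<^sub>R n1 + \<beta> *\<^sub>R n2) \<bullet> X = 0" "(\<alpha> *\<^sub>R n1 + \<beta> *\<^sub>R n2) \<bullet> Y = 0"
      by (simp_all add: inner_add_left inner_frame)
    then show ?thesis
      using norm_partial_v by (simp add: normal_space_iff sgn_div_norm)
  qed
  \<comment> \<open>Up to a factor, \<open>w\<close> is \<open>H\<close> turned by a right angle in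
    the normal plane. Its normalization shows that the choice of \<xi>2 is made from a nonempty
    set.\<close>
  define w where "w = (q + r) *\<^sub>R n1 + (- p) *\<^sub>R n2"
  have "w \<bullet> n2 \<noteq> 0" using assms by (simp add: w_def inner_diff_left inner_frame)
  then have "w \<noteq> 0" by auto
  have "w \<bullet> H = 0"
    by (simp add: w_def H(2) inner_diff_left inner_add_right inner_frame)
  then have "P (sgn w)"
    using \<open>w \<noteq> 0\<close> normal[of "q + r" "- p", folded w_def]
    by (simp add: P_def norm_sgn normal_space_iff orthogonal_def \<xi>1_def sgn_div_norm)
  then have "P \<xi>2" unfolding \<xi>2_def by (rule someI)
  then have \<xi>2: "\<xi>2 \<in> normal_space I J z u v" "norm \<xi>2 = 1" "\<xi>2 \<bullet> \<xi>1 = 0"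
    by (auto simp: P_def orthogonal_def)
  define \<alpha> \<beta> where "\<alpha> = \<xi>2 \<bullet> n1" and "\<beta> = \<xi>2 \<bullet> n2"
  have "\<xi>2 \<bullet> X = 0" "\<xi>2 \<bullet> Y = 0"
    using \<xi>2(1) by (simp_all add: normal_space_iff sgn_div_norm)
  then have \<xi>2_eq: "\<xi>2 = \<alpha> *\<^sub>R n1 + \<beta> *\<^sub>R n2"
    using orthonormal_frame_expand[OF frame, of \<xi>2] by (simp add: \<alpha>_def \<beta>_def)
  have "\<xi>2 \<bullet> H = 0" using \<xi>2(3) H(1) by (simp add: \<xi>1_def)
  then have ab: "\<alpha> * p + \<beta> * (q + r) = 0"
    by (simp add: \<alpha>_def \<beta>_def H(2) inner_add_right algebra_simps)
  have "\<beta> \<noteq> 0"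
  proof
    assume "\<beta> = 0"
    with ab assms have "\<xi>2 = 0" by (simp add: \<xi>2_eq)
    with \<xi>2(2) show False by simp
  qed
  have HX: "\<sigma> X X \<bullet> \<xi>1 = q * (q + r) / (2 * norm H)"
    and HY: "\<sigma> Y Y \<bullet> \<xi>1 = (p\<^sup>2 + r * (q + r)) / (2 * norm H)"
    unfolding \<sigma>_frame \<xi>1_def
    by (subst H(2), simp add: inner_add_left inner_add_right inner_frame power2_eq_square field_simps)+
  have \<xi>X: "\<sigma> X X \<bullet> \<xi>2 = q * \<beta>" and \<xi>Y: "\<sigma> Y Y \<bullet> \<xi>2 = p * \<alpha> + r * \<beta>"
    unfolding \<sigma>_frame \<alpha>_def \<beta>_def by (simp_all add: inner_add_left inner_add_right inner_commute)
  have "(norm H * 2) * ((\<sigma> X X \<bullet> \<xi>1) * (\<sigma> X X \<bullet> \<xi>2) + (\<sigma> Y Y \<bullet> \<xi>1) * (\<sigma> Y Y \<bullet> \<xi>2)) =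
      q * (q + r) * (q * \<beta>) + (p\<^sup>2 + r * (q + r)) * (p * \<alpha> + r * \<beta>)"
    unfolding HX HY \<xi>X \<xi>Y using H(1) by (simp add: field_simps)
  \<comment> \<open>Orthogonality to \<open>H\<close> eliminates \<alpha>, so that \<beta> factors
    out of the trace.\<close>
  also have "p * \<alpha> + r * \<beta> = - \<beta> * q" using ab by (simp add: algebra_simps)
  also have "q * (q + r) * (q * \<beta>) + (p\<^sup>2 + r * (q + r)) * (- \<beta> * q) =
      \<beta> * q * (q\<^sup>2 - (p\<^sup>2 + r\<^sup>2))"
    by (simp add: algebra_simps power2_eq_square)
  finally have "(\<sigma> X X \<bullet> \<xi>1) * (\<sigma> X X \<bullet> \<xi>2) + (\<sigma> Y Y \<bullet> \<xi>1) * (\<sigma> Y Y \<bullet> \<xi>2) = 0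
      \<longleftrightarrow> \<beta> * q * (q\<^sup>2 - (p\<^sup>2 + r\<^sup>2)) = 0"
    using H(1) by (metis mult_eq_0_iff norm_eq_zero zero_neq_numeral)
  also have "\<dots> \<longleftrightarrow> q\<^sup>2 = p\<^sup>2 + r\<^sup>2" using \<open>\<beta> \<noteq> 0\<close> assms by simp
  finally have tr: "tangent_trace I J z u v (shape_operator I J z u v \<xi>1 \<circ> shape_operator I J z u v \<xi>2) = 0
      \<longleftrightarrow> q\<^sup>2 = p\<^sup>2 + r\<^sup>2"
    by (simp only: tangent_trace_shape_operators)
  have "allied_mean_curvature_vector I J z u v = (norm H / 2 * tangent_trace I J z u v
      (shape_operator I J z u v \<xi>1 \<circ> shape_operator I J z u v \<xi>2)) *\<^sub>R \<xi>2"
    unfolding allied_mean_curvature_vector_def Let_def \<xi>2_def P_def \<xi>1_def H_def ..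
  moreover have "\<xi>2 \<noteq> 0" using \<xi>2(2) by auto
  ultimately show ?thesis using H(1) tr by simp
qed

end

subsection \<open>The geometry of a meridian surface\<close>

lemma R3_inner_axis_4: "x \<in> R3 \<Longrightarrow> x \<bullet> axis 4 1 = 0"
proof -
  assume "x \<in> R3"
  moreover have "orthogonal (axis 4 1 :: real^4) x" if "x \<in> span {axis 1 1, axis 2 1, axis 3 1}"
    by (rule orthogonal_to_span[OF that]) (auto simp: orthogonal_def inner_axis_axis)
  ultimately show ?thesis by (simp add: R3_def orthogonal_def inner_commute)
qed

locale meridian =
  fixes I J :: "real set" and f g :: "real \<Rightarrow> real" and l n :: "real \<Rightarrow> real^4"
  assumes I: "nondegenerate_interval I" and J: "nondegenerate_interval J"
    and meridian: "meridian_curve I f g"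
    and curve: "arclength_spherical_curve J l" and normal: "spherical_normal J l n"
begin

abbreviation f' :: "real \<Rightarrow> real" where "f' \<equiv> deriv_on I f"
abbreviation g' :: "real \<Rightarrow> real" where "g' \<equiv> deriv_on I g"
abbreviation f'' :: "real \<Rightarrow> real" where "f'' \<equiv> deriv_on I f'"
abbreviation g'' :: "real \<Rightarrow> real" where "g'' \<equiv> deriv_on I g'"
abbreviation t :: "real \<Rightarrow> real^4" where "t \<equiv> deriv_on J l"
abbreviation \<kappa> :: "real \<Rightarrow> real" where "\<kappa> \<equiv> spherical_curvature J l n"
abbreviation \<kappa>\<^sub>m :: "real \<Rightarrow> real" where "\<kappa>\<^sub>m \<equiv> meridian_curvature I f g"
abbreviation e4 :: "real^4" where "e4 \<equiv> axis 4 1"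
abbreviation z :: "real \<Rightarrow> real \<Rightarrow> real^4" where "z \<equiv> meridian_surface f g l"

section \<open>Moving frames along the meridian and the spherical curve\<close>

lemma f_nonzero: "u \<in> I \<Longrightarrow> f u \<noteq> 0"
  and unit_speed: "u \<in> I \<Longrightarrow> (f' u)\<^sup>2 + (g' u)\<^sup>2 = 1"
  and g'_pos: "u \<in> I \<Longrightarrow> g' u > 0"
  using meridian by (auto simp: meridian_curve_def)

lemma has_derivs:
  "u \<in> I \<Longrightarrow> (f has_vector_derivative f' u) (at u within I)"
  "u \<in> I \<Longrightarrow> (g has_vector_derivative g' u) (at u within I)"
  "u \<in> I \<Longrightarrow> (f' has_vector_derivative f'' u) (at u within I)"
  "u \<in> I \<Longrightarrow> (g' has_vector_derivative g'' u) (at u within I)"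
  "v \<in> J \<Longrightarrow> (l has_vector_derivative t v) (at v within J)"
  "v \<in> J \<Longrightarrow> (t has_vector_derivative deriv_on J t v) (at v within J)"
  "v \<in> J \<Longrightarrow> (n has_vector_derivative deriv_on J n v) (at v within J)"
  using meridian curve normal
  by (auto simp: meridian_curve_def arclength_spherical_curve_def spherical_normal_def
      intro!: smooth_on_has_vector_derivative smooth_on_deriv_on)

lemma unit_speed_deriv:
  assumes "u \<in> I" shows "f' u * f'' u + g' u * g'' u = 0"
proof -
  have "((\<lambda>u. (f' u, g' u)) has_vector_derivative (f'' u, g'' u)) (at u within I)"
    using has_derivs(3,4)[OF assms] by (rule has_vector_derivative_Pair)
  from inner_const_imp_derivs[OF I assms this this, of 1]
  show ?thesis using unit_speed by (simp add: inner_prod_def power2_eq_square algebra_simps)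
qed

text \<open>The definition of \<open>\<kappa>\<^sub>m\<close> and the differentiated unit speed
  condition form a linear system for \<open>f''\<close> and \<open>g''\<close> whose determinant has
  absolute value 1.\<close>

lemma second_derivs:
  assumes "u \<in> I"
  shows "f'' u = - (\<kappa>\<^sub>m u * g' u)" "g'' u = \<kappa>\<^sub>m u * f' u"
  using unit_speed[OF assms] unit_speed_deriv[OF assms]
  unfolding meridian_curvature_def power2_eq_square by algebra+

text \<open>Differentiating \<open>l \<bullet> l = 1\<close> and \<open>l \<bullet> e4 = 0\<close>
  gives the relations of \<open>t\<close> with \<open>l\<close> and \<open>e4\<close>; the others
  are part of the hypotheses on \<open>l\<close> and \<open>n\<close>.\<close>

lemma frame_J:
  assumes "v \<in> J" shows "orthonormal_frame (t v) (n v) (l v) e4"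
proof -
  have l: "l w \<in> R3" "l w \<bullet> l w = 1" "t w \<bullet> t w = 1" if "w \<in> J" for w
    using curve that by (auto simp: arclength_spherical_curve_def S2_def norm_eq_1)
  have "l v \<bullet> t v = 0"
    using inner_const_imp_derivs[OF J assms has_derivs(5)[OF assms] has_derivs(5)[OF assms], of 1] l(2)
    by (simp add: inner_commute)
  moreover have "t v \<bullet> e4 = 0"
    using inner_const_imp_derivs[OF J assms has_derivs(5)[OF assms]
        has_vector_derivative_const[of e4], of 0] l(1) by (simp add: R3_inner_axis_4)
  moreover have "n v \<bullet> n v = 1" "n v \<bullet> e4 = 0" "n v \<bullet> l v = 0" "n v \<bullet> t v = 0"
    using normal assms
    by (auto simp: spherical_normal_def norm_eq_1 R3_inner_axis_4 orthogonal_def)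
  ultimately show ?thesis
    using l[OF assms]
    by (simp add: orthonormal_frame_def R3_inner_axis_4 inner_commute inner_axis_axis)
qed

lemma inner_frame_J:
  assumes "v \<in> J"
  shows "t v \<bullet> t v = 1" "n v \<bullet> n v = 1" "l v \<bullet> l v = 1" "e4 \<bullet> e4 = 1"
    "t v \<bullet> n v = 0" "t v \<bullet> l v = 0" "t v \<bullet> e4 = 0" "n v \<bullet> l v = 0" "n v \<bullet> e4 = 0" "l v \<bullet> e4 = 0"
    "n v \<bullet> t v = 0" "l v \<bullet> t v = 0" "e4 \<bullet> t v = 0" "l v \<bullet> n v = 0" "e4 \<bullet> n v = 0" "e4 \<bullet> l v = 0"
  using frame_J[OF assms] by (auto simp: orthonormal_frame_def inner_commute)

text \<open>Both sides have the same components in the frame \<open>t\<close>, \<open>n\<close>,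
  \<open>l\<close>, \<open>e4\<close>. The component of \<open>t'\<close> along \<open>n\<close> is
  \<kappa> by definition, and each other component comes from differentiating an orthonormality
  relation.\<close>

lemma frenet:
  assumes "v \<in> J"
  shows "deriv_on J t v = \<kappa> v *\<^sub>R n v - l v" "deriv_on J n v = - \<kappa> v *\<^sub>R t v"
proof -
  note ip = inner_const_imp_derivs[OF J assms]
  note d = has_derivs(5-7)[OF assms] has_vector_derivative_const[of e4 "at v within J"]
  have t: "deriv_on J t v \<bullet> t v = 0"
    using ip[OF d(2,2), of 1] inner_frame_J by (simp add: inner_commute)
  have tl: "deriv_on J t v \<bullet> l v = -1"
    using ip[OF d(2,1), of 0] inner_frame_J assms by (simp add: inner_commute)
  have te: "deriv_on J t v \<bullet> e4 = 0"
    using ip[OF d(2,4), of 0] inner_frame_J by simp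
  show "deriv_on J t v = \<kappa> v *\<^sub>R n v - l v"
    by (rule orthonormal_frame_eqI[OF frame_J[OF assms]])
      (simp_all add: inner_diff_left inner_frame_J[OF assms] t tl te spherical_curvature_def)
  have "deriv_on J n v \<bullet> n v = 0"
    using ip[OF d(3,3), of 1] inner_frame_J by (simp add: inner_commute)
  moreover have "deriv_on J n v \<bullet> l v = 0"
    using ip[OF d(3,1), of 0] inner_frame_J assms by (simp add: inner_commute)
  moreover have "deriv_on J n v \<bullet> e4 = 0"
    using ip[OF d(3,4), of 0] inner_frame_J by simp
  moreover have "deriv_on J n v \<bullet> t v = - \<kappa> v"
    using ip[OF d(3,2), of 0] inner_frame_J
    by (simp add: spherical_curvature_def inner_commute)
  ultimately show "deriv_on J n v = - \<kappa> v *\<^sub>R t v"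
    by (intro orthonormal_frame_eqI[OF frame_J[OF assms]]) (simp_all add: inner_frame_J[OF assms])
qed

section \<open>The second fundamental tensor of a meridian surface\<close>

lemma partial_derivatives:
  assumes "u \<in> I" "v \<in> J"
  shows "partial_u I z u v = f' u *\<^sub>R l v + g' u *\<^sub>R e4"
    and "partial_v J z u v = f u *\<^sub>R t v"
    and "partial_u I (partial_u I z) u v = f'' u *\<^sub>R l v + g'' u *\<^sub>R e4"
    and "partial_u I (partial_v J z) u v = f' u *\<^sub>R t v"
    and "partial_v J (partial_u I z) u v = f' u *\<^sub>R t v"
    and "partial_v J (partial_v J z) u v = f u *\<^sub>R (\<kappa> v *\<^sub>R n v - l v)"
proof -
  have u: "deriv_on I (\<lambda>s. h s *\<^sub>R x + k s *\<^sub>R y) u = h' *\<^sub>R x + k' *\<^sub>R y"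
    if "(h has_vector_derivative h') (at u within I)" "(k has_vector_derivative k') (at u within I)"
    for h k :: "real \<Rightarrow> real" and x y :: "real^4" and h' k'
    using that unfolding has_vector_derivative_def
    by (intro deriv_on_eq[OF I assms(1)])
      (auto simp: has_vector_derivative_def algebra_simps intro!: derivative_eq_intros)
  have v: "deriv_on J (\<lambda>s. c *\<^sub>R h s + x) v = c *\<^sub>R h'"
    if "(h has_vector_derivative h') (at v within J)" for h :: "real \<Rightarrow> real^4" and c x h'
    using that unfolding has_vector_derivative_def
    by (intro deriv_on_eq[OF J assms(2)])
      (auto simp: has_vector_derivative_def algebra_simps intro!: derivative_eq_intros)
  have c0: "((\<lambda>s. 0) has_vector_derivative (0::real)) (at u within I)" by simp
  \<comment> \<open>The two first partial derivatives are computed with the other parameter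
    arbitrary, so that they can be differentiated again in either variable.\<close>
  have pu: "partial_u I z s w = f' s *\<^sub>R l w + g' s *\<^sub>R e4" if "s \<in> I" for s w
    unfolding partial_u_def meridian_surface_def
    by (rule deriv_on_eq[OF I that])
      (use has_derivs(1,2)[OF that] in \<open>auto simp: has_vector_derivative_def algebra_simps
        intro!: derivative_eq_intros\<close>)
  have pv: "partial_v J z s w = f s *\<^sub>R t w" if "w \<in> J" for s w
    unfolding partial_v_def meridian_surface_def
    by (rule deriv_on_eq[OF J that])
      (use has_derivs(5)[OF that] in \<open>auto simp: has_vector_derivative_def algebra_simps
        intro!: derivative_eq_intros\<close>)
  show "partial_u I z u v = f' u *\<^sub>R l v + g' u *\<^sub>R e4" by (rule pu[OF assms(1)])
  show "partial_v J z u v = f u *\<^sub>R t v" by (rule pv[OF assms(2)])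
  have "partial_u I (partial_u I z) u v = deriv_on I (\<lambda>s. f' s *\<^sub>R l v + g' s *\<^sub>R e4) u"
    unfolding partial_u_def[of I "partial_u I z"] by (rule deriv_on_cong) (use assms pu in auto)
  then show "partial_u I (partial_u I z) u v = f'' u *\<^sub>R l v + g'' u *\<^sub>R e4"
    using u[OF has_derivs(3,4)] assms by simp
  have "partial_u I (partial_v J z) u v = f' u *\<^sub>R t v + 0 *\<^sub>R 0"
    unfolding partial_u_def pv[OF assms(2)]
    using u[OF has_derivs(1) c0, of "t v" 0] assms by simp
  then show "partial_u I (partial_v J z) u v = f' u *\<^sub>R t v" by simp
  show "partial_v J (partial_u I z) u v = f' u *\<^sub>R t v"
    unfolding partial_v_def pu[OF assms(1)] using v has_derivs(5) assms by blast
  have "partial_v J (partial_v J z) u v = deriv_on J (\<lambda>s. f u *\<^sub>R t s + 0) v"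
    unfolding partial_v_def[of J "partial_v J z"] by (rule deriv_on_cong) (use assms pv in auto)
  then show "partial_v J (partial_v J z) u v = f u *\<^sub>R (\<kappa> v *\<^sub>R n v - l v)"
    using v[OF has_derivs(6)] frenet(1) assms by metis
qed

text \<open>The second partial derivatives are split into tangential and normal parts. The mixed
  ones are multiples of \<open>t\<close>, hence tangential; \<open>z_vv\<close> has normal part
  \<open>f * \<kappa>\<close> along \<open>n\<close> and \<open>f * g'\<close> along
  \<open>?n2\<close>, and dividing by the squared length \<open>f\<^sup>2\<close> of
  \<open>z_v\<close> gives \<open>\<kappa> / f\<close> and \<open>g' / f\<close>.\<close>

lemma orthogonal_net_point:
  assumes "u \<in> I" "v \<in> J"
  shows "orthogonal_net_point I J z u v (n v) (- g' u *\<^sub>R l v + f' u *\<^sub>R e4)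
    (\<kappa> v / f u) (\<kappa>\<^sub>m u) (g' u / f u)"
proof
  note pd = partial_derivatives[OF assms]
  note ip = inner_add_left inner_add_right inner_diff_left inner_diff_right
    inner_frame_J[OF assms(2)]
  note T = tangent_space_def pd(1,2)
  let ?n2 = "- g' u *\<^sub>R l v + f' u *\<^sub>R e4"
  let ?X = "f' u *\<^sub>R l v + g' u *\<^sub>R e4"
  have norm_t: "norm (t v) = 1" using inner_frame_J[OF assms(2)] by (simp add: norm_eq_1)
  have us: "f' u * f' u + g' u * g' u = 1" "g' u * g' u + f' u * f' u = 1"
    using unit_speed[OF assms(1)] by (simp_all add: power2_eq_square)
  \<comment> \<open>Since \<open>f\<close> may be negative, the normalized \<open>z_v\<close> is
    \<open>t\<close> or \<open>- t\<close>; the frame relations involve this sign only through its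
    square or multiplied by zero.\<close>
  have f: "sgn (f u) * sgn (f u) = 1" "f u \<noteq> 0" using f_nonzero[OF assms(1)] by (simp_all add: sgn_if)
  have "sgn (t v) = t v" using norm_t by (simp add: sgn_div_norm)
  then show "orthonormal_frame (partial_u I z u v) (sgn (partial_v J z u v)) (n v) ?n2"
    unfolding orthonormal_frame_def pd sgn_scaleR using us f by (simp add: ip)
  have nrm: "n v \<in> normal_space I J z u v" "?n2 \<in> normal_space I J z u v"
    by (simp_all add: normal_space_iff pd ip)
  then have nrm': "a *\<^sub>R n v + b *\<^sub>R ?n2 \<in> normal_space I J z u v" for a b
    by (simp add: normal_space_iff inner_add_left)
  have tan: "a *\<^sub>R ?X + b *\<^sub>R t v \<in> tangent_space I J z u v" for a b
  proof -
    have "a *\<^sub>R ?X + (b / f u) *\<^sub>R (f u *\<^sub>R t v) \<in> tangent_space I J z u v"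
      unfolding T by (intro span_add span_mul span_base) auto
    then show ?thesis using f by simp
  qed
  show "normal_part I J z u v (partial_u I (partial_u I z) u v) = \<kappa>\<^sub>m u *\<^sub>R ?n2"
  proof (rule normal_part_eq)
    show "\<kappa>\<^sub>m u *\<^sub>R ?n2 \<in> normal_space I J z u v" using nrm'[of 0] by simp
    have "partial_u I (partial_u I z) u v - \<kappa>\<^sub>m u *\<^sub>R ?n2 = 0 *\<^sub>R ?X + 0 *\<^sub>R t v"
      unfolding pd second_derivs[OF assms(1)] by (simp add: algebra_simps)
    then show "partial_u I (partial_u I z) u v - \<kappa>\<^sub>m u *\<^sub>R ?n2 \<in> tangent_space I J z u v"
      using tan by metis
  qed
  have "normal_part I J z u v (f' u *\<^sub>R t v) = 0"
    by (rule normal_part_eq) (use nrm'[of 0 0] tan[of 0 "f' u"] in simp_all)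
  then show "normal_part I J z u v (partial_u I (partial_v J z) u v) = 0"
    "normal_part I J z u v (partial_v J (partial_u I z) u v) = 0"
    by (simp_all only: pd)
  have "normal_part I J z u v (f u *\<^sub>R (\<kappa> v *\<^sub>R n v - l v)) =
      (f u * \<kappa> v) *\<^sub>R n v + (f u * g' u) *\<^sub>R ?n2"
  proof (rule normal_part_eq[OF nrm'])
    \<comment> \<open>Unit speed makes \<open>?X\<close> and \<open>?n2\<close> a rotation of
      \<open>l\<close> and \<open>e4\<close>, which expresses \<open>l\<close> through its
      tangential and normal parts.\<close>
    have "l v = (f' u * f' u + g' u * g' u) *\<^sub>R l v" by (simp only: us scaleR_one)
    then have "l v = f' u *\<^sub>R ?X - g' u *\<^sub>R ?n2" by (simp add: algebra_simps)
    then have "f u *\<^sub>R (\<kappa> v *\<^sub>R n v - l v) - ((f u * \<kappa> v) *\<^sub>R n v + (f u * g' u) *\<^sub>R ?n2)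
        = f u *\<^sub>R (\<kappa> v *\<^sub>R n v - (f' u *\<^sub>R ?X - g' u *\<^sub>R ?n2)) - ((f u * \<kappa> v) *\<^sub>R n v + (f u * g' u) *\<^sub>R ?n2)"
      by simp
    also have "\<dots> = (- f u * f' u) *\<^sub>R ?X + 0 *\<^sub>R t v"
      by (simp add: algebra_simps)
    finally show "f u *\<^sub>R (\<kappa> v *\<^sub>R n v - l v) - ((f u * \<kappa> v) *\<^sub>R n v + (f u * g' u) *\<^sub>R ?n2)
        \<in> tangent_space I J z u v" using tan by metis
  qed
  also have "\<dots> = (f u)\<^sup>2 *\<^sub>R ((\<kappa> v / f u) *\<^sub>R n v + (g' u / f u) *\<^sub>R ?n2)"
    using f by (simp add: scaleR_add_right power2_eq_square del: scaleR_left.minus)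
  finally show "normal_part I J z u v (partial_v J (partial_v J z) u v) =
      (norm (partial_v J z u v))\<^sup>2 *\<^sub>R ((\<kappa> v / f u) *\<^sub>R n v + (g' u / f u) *\<^sub>R ?n2)"
    by (simp only: pd norm_scaleR norm_t mult_1_right real_norm_def power2_abs)
qed

text \<open>The pointwise criterion \<open>q\<^sup>2 = p\<^sup>2 + r\<^sup>2\<close> is multiplied
  by \<open>f\<^sup>2\<close>. Nonvanishing \<kappa> also ensures that \<open>H\<close> has no
  zeros.\<close>

lemma Chen_surface_iff:
  assumes "general_class I J f g l n"
  shows "Chen_surface I J z \<longleftrightarrow> (\<forall>u\<in>I. \<forall>v\<in>J. (f u * \<kappa>\<^sub>m u)\<^sup>2 = (\<kappa> v)\<^sup>2 + (g' u)\<^sup>2)"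
proof -
  have "mean_curvature_vector I J z u v \<noteq> 0 \<and>
      (allied_mean_curvature_vector I J z u v = 0 \<longleftrightarrow> (f u * \<kappa>\<^sub>m u)\<^sup>2 = (\<kappa> v)\<^sup>2 + (g' u)\<^sup>2)"
    if uv: "u \<in> I" "v \<in> J" for u v
  proof -
    interpret orthogonal_net_point I J z u v "n v" "- g' u *\<^sub>R l v + f' u *\<^sub>R e4"
      "\<kappa> v / f u" "\<kappa>\<^sub>m u" "g' u / f u"
      by (rule orthogonal_net_point[OF uv])
    have nz: "\<kappa> v / f u \<noteq> 0" "\<kappa>\<^sub>m u \<noteq> 0"
      using assms uv f_nonzero by (auto simp: general_class_def)
    have "(\<kappa>\<^sub>m u)\<^sup>2 = (\<kappa> v / f u)\<^sup>2 + (g' u / f u)\<^sup>2 \<longleftrightarrow> (f u * \<kappa>\<^sub>m u)\<^sup>2 = (\<kappa> v)\<^sup>2 + (g' u)\<^sup>2"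
      using f_nonzero[OF uv(1)] by (simp add: field_simps)
    then show ?thesis
      using allied_mean_curvature_vector_eq_0_iff[OF nz] mean_curvature_vector_nonzero[OF nz(1)]
      by simp
  qed
  then show ?thesis unfolding Chen_surface_def by blast
qed

end

subsection \<open>The differential equation of the meridian\<close>

lemma connected_nonzero_sign:
  fixes h :: "real \<Rightarrow> real"
  assumes "connected S" "continuous_on S h" "\<And>x. x \<in> S \<Longrightarrow> h x \<noteq> 0"
  shows "(\<forall>x\<in>S. h x > 0) \<or> (\<forall>x\<in>S. h x < 0)"
proof (rule ccontr)
  assume "\<not> ?thesis"
  then obtain x y where "x \<in> S" "y \<in> S" "h x \<le> 0" "0 \<le> h y"
    by (meson not_less)
  moreover have "connected (h ` S)" using assms by (intro connected_continuous_image)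
  ultimately have "0 \<in> h ` S" by (meson connectedD_interval imageI)
  then show False using assms(3) by auto
qed

lemma powi_double: "(x::real) powi (2 * s) = (x powi s)\<^sup>2"
  by (simp add: mult.commute[of 2] power_int_mult)

lemma sgn_powi_unit: "s \<in> {1, -1} \<Longrightarrow> sgn ((x::real) powi s) = sgn x"
  by (auto simp: power_int_minus sgn_inverse)

text \<open>With \<open>P = x powi s\<close> and \<open>c = b\<^sup>2 / a\<close>, the factor
  \<open>P\<close> is pulled out of \<open>P\<^sup>2 - c\<close>. When the radicand is nonnegative
  and the leading sign is 1 or -1, the square of \<open>chen_y\<close> is thus
  \<open>1 - (a / 4) * (P - c / P)\<^sup>2\<close>, which unit speed turns into a formula for
  \<open>g'\<^sup>2\<close>.\<close>

lemma chen_radicand_eq: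
  assumes "x \<noteq> 0"
  shows "chen_radicand s a b x =
    4 * (x powi s)\<^sup>2 * (1 - (a / 4) * (x powi s - (b\<^sup>2 / a) / x powi s)\<^sup>2)"
proof -
  define P c where "P = x powi s" and "c = b\<^sup>2 / a"
  have "P \<noteq> 0" using assms by (simp add: P_def)
  then have "P\<^sup>2 - c = P * (P - c / P)"
    by (simp add: field_simps power2_eq_square)
  then have "(P\<^sup>2 - c)\<^sup>2 = P\<^sup>2 * (P - c / P)\<^sup>2" by (simp only: power_mult_distrib)
  then show ?thesis
    unfolding chen_radicand_def powi_double P_def[symmetric] c_def[symmetric]
    by (simp add: right_diff_distrib)
qed

context meridian
begin

lemma I_nonempty: "I \<noteq> {}" and J_nonempty: "J \<noteq> {}"
  using I J by (auto simp: nondegenerate_interval_def)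

lemma convex_I: "convex I" and convex_J: "convex J" and connected_I: "connected I"
  using I J by (auto simp: nondegenerate_interval_def is_interval_convex is_interval_connected)

lemma continuous_on_I:
  "continuous_on I f" "continuous_on I f'" "continuous_on I g'" "continuous_on I \<kappa>\<^sub>m"
proof -
  have s: "smooth_on I f" "smooth_on I g" using meridian by (auto simp: meridian_curve_def)
  show "continuous_on I f" "continuous_on I f'" "continuous_on I g'"
    using s by (auto intro: smooth_on_continuous_on smooth_on_deriv_on)
  show "continuous_on I \<kappa>\<^sub>m"
    unfolding meridian_curvature_def[abs_def]
    by (intro continuous_intros smooth_on_continuous_on[OF smooth_on_deriv_on]
        smooth_on_continuous_on[OF smooth_on_deriv_on[OF smooth_on_deriv_on]] s)
qed

text \<open>By the Frenet formulas \<open>n + b l\<close> has derivative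
  \<open>- \<kappa> t + b t = 0\<close>. This constant vector has length
  \<open>sqrt (1 + b\<^sup>2)\<close> and inner product \<open>b\<close> with \<open>l\<close>, so
  after normalization it is the axis of the circle.\<close>

lemma constant_curvature_imp_circle:
  assumes "\<And>v. v \<in> J \<Longrightarrow> \<kappa> v = b"
  shows "\<exists>C. circle_on_S2 C \<and> l ` J \<subseteq> C"
proof -
  define w where "w v = n v + b *\<^sub>R l v" for v
  have "(w has_vector_derivative 0) (at v within J)" if v: "v \<in> J" for v
  proof -
    have "(w has_vector_derivative deriv_on J n v + b *\<^sub>R t v) (at v within J)"
      unfolding w_def using has_derivs(5,7)[OF v]
      by (auto simp: has_vector_derivative_def algebra_simps intro!: derivative_eq_intros)
    then show ?thesis by (simp add: frenet(2)[OF v] assms[OF v])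
  qed
  then obtain w0 where w0: "w v = w0" if "v \<in> J" for v
    using has_vector_derivative_zero_constant[OF convex_J] by metis
  obtain v0 where v0: "v0 \<in> J" using J_nonempty by blast
  define N where "N = sqrt (1 + b\<^sup>2)"
  have N: "N > 0" "N\<^sup>2 = 1 + b\<^sup>2" by (simp_all add: N_def add_pos_nonneg)
  have lS2: "l v \<in> S2" if "v \<in> J" for v
    using curve that by (auto simp: arclength_spherical_curve_def)
  have R3: "subspace R3" unfolding R3_def by (rule subspace_span)
  have "n v0 \<in> R3" "l v0 \<in> R3"
    using normal lS2 v0 by (auto simp: spherical_normal_def S2_def)
  then have "w0 /\<^sub>R N \<in> R3"
    unfolding w0[OF v0, symmetric] w_def using R3 by (intro subspace_mul subspace_add)
  moreover have "w0 \<bullet> w0 = N\<^sup>2"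
    unfolding w0[OF v0, symmetric] w_def N(2)
    by (simp add: inner_add_left inner_add_right inner_frame_J[OF v0] power2_eq_square)
  then have "norm w0 = N" using N(1) by (simp add: norm_eq_sqrt_inner)
  then have "norm (w0 /\<^sub>R N) = 1" using N(1) by simp
  ultimately have "w0 /\<^sub>R N \<in> S2" by (simp add: S2_def)
  moreover have "(w0 /\<^sub>R N) \<bullet> l v = b / N" if "v \<in> J" for v
    unfolding w0[OF that, symmetric] w_def
    by (simp add: inner_add_left inner_frame_J[OF that] divide_inverse)
  \<comment> \<open>The strict bound rules out a circle that degenerates to a point.\<close>
  moreover have "\<bar>b / N\<bar> < 1"
  proof -
    have "\<bar>b\<bar> < N" by (rule power2_less_imp_less) (use N in auto)
    then show ?thesis using N(1) by simp
  qed
  ultimately show ?thesis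
    unfolding circle_on_S2_def using lS2
    by (intro exI[of _ "{x \<in> S2. (w0 /\<^sub>R N) \<bullet> x = b / N}"]) blast
qed

section \<open>Equivalence of the formula for \<open>f'\<close> with the curvature equation\<close>

lemma powi_deriv:
  assumes "u \<in> I"
  shows "((\<lambda>u. f u powi s) has_real_derivative s * f' u * f u powi s / f u) (at u within I)"
proof -
  have "(f has_real_derivative f' u) (at u within I)"
    using has_derivs(1)[OF assms] by (simp add: has_real_derivative_iff_has_vector_derivative)
  then show ?thesis
    using f_nonzero[OF assms]
    by (auto intro!: derivative_eq_intros simp: power_int_diff)
qed

text \<open>Squaring removes the leading sign and gives \<open>g'\<^sup>2\<close> in terms of
  \<open>P\<close> on all of \<open>I\<close>. Its derivative also equals
  \<open>2 * g' * \<kappa>\<^sub>m * f'\<close>, so dividing by \<open>f'\<close> determines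
  \<open>f * \<kappa>\<^sub>m\<close> where \<open>f'\<close> is nonzero; the remaining points
  follow by continuity.\<close>

lemma meridian_determined_imp_curvature_eq:
  assumes \<kappa>m: "\<And>u. u \<in> I \<Longrightarrow> \<kappa>\<^sub>m u \<noteq> 0"
    and a: "a \<noteq> 0" and s: "s \<in> {1, -1}" and det: "meridian_determined_by_y I f g s a b"
    and u: "u \<in> I"
  shows "(f u * \<kappa>\<^sub>m u)\<^sup>2 = b\<^sup>2 + (g' u)\<^sup>2"
proof -
  define c where "c = b\<^sup>2 / a"
  define P where "P u = f u powi s" for u
  have P: "P u \<noteq> 0" if "u \<in> I" for u using f_nonzero[OF that] by (simp add: P_def)
  have g'_eq: "(g' u)\<^sup>2 = (a / 4) * (P u - c / P u)\<^sup>2" if u: "u \<in> I" for u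
  proof -
    obtain \<epsilon> where "\<epsilon> \<in> {1, -1}" "chen_radicand s a b (f u) \<ge> 0" "f' u = chen_y \<epsilon> s a b (f u)"
      using det u unfolding meridian_determined_by_y_def by blast
    then have "(f' u)\<^sup>2 = chen_radicand s a b (f u) / (4 * (P u)\<^sup>2)"
      by (auto simp: chen_y_def P_def power_mult_distrib power_divide)
    also have "\<dots> = 1 - (a / 4) * (P u - c / P u)\<^sup>2"
      using P[OF u] by (simp add: chen_radicand_eq[OF f_nonzero[OF u]] P_def c_def)
    finally show ?thesis using unit_speed[OF u] by simp
  qed
  have regular: "(f u * \<kappa>\<^sub>m u)\<^sup>2 = b\<^sup>2 + (g' u)\<^sup>2" if u: "u \<in> I" "f' u \<noteq> 0" for u
  proof -
    \<comment> \<open>The variables \<open>x\<close>, \<open>y\<close>, \<open>d\<close>,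
      \<open>p\<close>, \<open>q\<close>, \<open>w\<close> stand for \<open>g'\<close>,
      \<open>\<kappa>\<^sub>m\<close>, \<open>f'\<close>, \<open>P - c / P\<close>,
      \<open>P + c / P\<close> and \<open>f\<close>.\<close>
    have cancel: "x * (w * y) = a / 4 * p * q * s"
      if "2 * x * (y * d) = a / 2 * p * q * s * d / w" "d \<noteq> 0" "w \<noteq> 0" for x y d p q w :: real
      using that by (simp add: field_simps)
    have dP: "(P has_real_derivative s * f' u * P u / f u) (at u within I)"
      unfolding P_def using powi_deriv[OF u(1)] .
    have dg: "(g' has_real_derivative g'' u) (at u within I)"
      using has_derivs(4)[OF u(1)] by (simp add: has_real_derivative_iff_has_vector_derivative)
    have "((\<lambda>u. (g' u)\<^sup>2) has_real_derivative 2 * g' u * g'' u) (at u within I)"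
      by (auto intro!: derivative_eq_intros dg)
    then have 1: "deriv_on I (\<lambda>u. (g' u)\<^sup>2) u = 2 * g' u * g'' u"
      using deriv_on_eq[OF I u(1)] by (simp add: has_real_derivative_iff_has_vector_derivative)
    have "((\<lambda>u. (a / 4) * (P u - c / P u)\<^sup>2) has_real_derivative
        (a / 2) * (P u - c / P u) * (P u + c / P u) * s * f' u / f u) (at u within I)"
    proof -
      define W where "W = s * f' u * P u / f u"
      \<comment> \<open>\<open>P\<close> and \<open>c / P\<close> have opposite logarithmic
        derivatives, so differentiating their difference produces their sum.\<close>
      have "W - (0 * P u - c * W) / (P u * P u) = (P u + c / P u) * s * f' u / f u"
        using P[OF u(1)] f_nonzero[OF u(1)]
        by (simp add: W_def divide_simps) (simp add: algebra_simps)
      moreover have "((\<lambda>u. P u - c / P u) has_real_derivative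
          W - (0 * P u - c * W) / (P u * P u)) (at u within I)"
        unfolding W_def by (rule DERIV_diff[OF dP DERIV_divide[OF DERIV_const dP P[OF u(1)]]])
      ultimately have "((\<lambda>u. P u - c / P u) has_real_derivative
          (P u + c / P u) * s * f' u / f u) (at u within I)" by simp
      from DERIV_cmult[OF DERIV_power[OF this, of 2], of "a / 4"] show ?thesis
        by (rule DERIV_cong) simp
    qed
    then have "deriv_on I (\<lambda>u. (a / 4) * (P u - c / P u)\<^sup>2) u =
        (a / 2) * (P u - c / P u) * (P u + c / P u) * s * f' u / f u"
      using deriv_on_eq[OF I u(1)] by (simp add: has_real_derivative_iff_has_vector_derivative)
    moreover have "deriv_on I (\<lambda>u. (g' u)\<^sup>2) u = deriv_on I (\<lambda>u. (a / 4) * (P u - c / P u)\<^sup>2) u"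
      by (rule deriv_on_cong) (use u g'_eq in auto)
    ultimately have "2 * g' u * (\<kappa>\<^sub>m u * f' u) =
        (a / 2) * (P u - c / P u) * (P u + c / P u) * s * f' u / f u"
      using 1 second_derivs(2)[OF u(1)] by simp
    then have "g' u * (f u * \<kappa>\<^sub>m u) = (a / 4) * (P u - c / P u) * (P u + c / P u) * s"
      by (rule cancel[OF _ u(2) f_nonzero[OF u(1)]])
    then have "(g' u)\<^sup>2 * (f u * \<kappa>\<^sub>m u)\<^sup>2 =
        ((a / 4) * (P u - c / P u) * (P u + c / P u) * s)\<^sup>2"
      by (metis power_mult_distrib)
    \<comment> \<open>One factor \<open>(a / 4) * (P - c / P)\<^sup>2\<close> is
      \<open>g'\<^sup>2\<close> again, and the square of \<open>s\<close> is 1. The positive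
      \<open>g'\<close> can then be cancelled.\<close>
    also have "\<dots> = (g' u)\<^sup>2 * ((a / 4) * (P u + c / P u)\<^sup>2)"
      unfolding g'_eq[OF u(1)] using s by (auto simp: power2_eq_square ac_simps)
    finally have "(f u * \<kappa>\<^sub>m u)\<^sup>2 = (a / 4) * (P u + c / P u)\<^sup>2"
      using g'_pos[OF u(1)] by simp
    \<comment> \<open>The squares of sum and difference differ by \<open>4 * c\<close>, and
      \<open>a * c = b\<^sup>2\<close>.\<close>
    also have "\<dots> = (a / 4) * (P u - c / P u)\<^sup>2 + a * c"
      using P[OF u(1)] by (simp add: power2_eq_square algebra_simps)
    also have "\<dots> = b\<^sup>2 + (g' u)\<^sup>2" using a by (simp add: g'_eq[OF u(1)] c_def)
    finally show ?thesis .
  qed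
  show ?thesis
  proof (cases "f' u = 0")
    case False
    then show ?thesis using regular u by blast
  next
    case True
    \<comment> \<open>A zero of \<open>f'\<close> is simple because
      \<open>f'' = - \<kappa>\<^sub>m g'\<close>. Hence \<open>f'\<close> is nonzero at nearby other
      points of \<open>I\<close>, where the regular case applies.\<close>
    have "f'' u \<noteq> 0" using second_derivs(1)[OF u] \<kappa>m[OF u] g'_pos[OF u] by simp
    moreover have "((\<lambda>y. (f' y - f' u) / (y - u)) \<longlongrightarrow> f'' u) (at u within I)"
      using has_derivs(3)[OF u]
      by (simp add: has_real_derivative_iff_has_vector_derivative[symmetric] has_field_derivative_iff)
    ultimately have "\<forall>\<^sub>F y in at u within I. (f' y - f' u) / (y - u) \<noteq> 0"
      using tendsto_imp_eventually_ne by blast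
    then have "\<forall>\<^sub>F y in at u within I. f' y \<noteq> 0 \<and> y \<in> I"
      using True eventually_at_topological by (auto simp: eventually_at_filter elim: eventually_mono)
    then have ev: "\<forall>\<^sub>F y in at u within I. (f y * \<kappa>\<^sub>m y)\<^sup>2 - (b\<^sup>2 + (g' y)\<^sup>2) = 0"
      by (rule eventually_mono) (use regular in auto)
    have "continuous_on I (\<lambda>y. (f y * \<kappa>\<^sub>m y)\<^sup>2 - (b\<^sup>2 + (g' y)\<^sup>2))"
      by (intro continuous_intros continuous_on_I)
    then have "((\<lambda>y. (f y * \<kappa>\<^sub>m y)\<^sup>2 - (b\<^sup>2 + (g' y)\<^sup>2)) \<longlongrightarrow>
        (f u * \<kappa>\<^sub>m u)\<^sup>2 - (b\<^sup>2 + (g' u)\<^sup>2)) (at u within I)"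
      using u by (simp add: continuous_on_def)
    moreover have "((\<lambda>y. (f y * \<kappa>\<^sub>m y)\<^sup>2 - (b\<^sup>2 + (g' y)\<^sup>2)) \<longlongrightarrow> 0) (at u within I)"
      by (rule tendsto_eventually[OF ev])
    ultimately have "(f u * \<kappa>\<^sub>m u)\<^sup>2 - (b\<^sup>2 + (g' u)\<^sup>2) = 0"
      by (rule tendsto_unique[OF nondegenerate_interval_at_within[OF I u]])
    then show ?thesis by simp
  qed
qed

text \<open>Taking the root of the hypothesis leaves a sign that is constant on \<open>I\<close> and
  becomes the exponent \<open>s\<close>. This yields a linear first-order equation for
  \<open>Q\<close> with the solutions \<open>k * f powi s\<close>.\<close>

lemma curvature_eq_imp_meridian_determined:
  assumes \<kappa>m: "\<And>u. u \<in> I \<Longrightarrow> \<kappa>\<^sub>m u \<noteq> 0" and b: "b > 0"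
    and eq: "\<And>u. u \<in> I \<Longrightarrow> (f u * \<kappa>\<^sub>m u)\<^sup>2 = b\<^sup>2 + (g' u)\<^sup>2"
  shows "\<exists>a s. a \<noteq> 0 \<and> s \<in> {1, -1} \<and> meridian_determined_by_y I f g s a b"
proof -
  define D where "D u = sqrt (b\<^sup>2 + (g' u)\<^sup>2)" for u
  define Q where "Q u = g' u + D u" for u
  have D: "D u > 0" "(D u)\<^sup>2 = b\<^sup>2 + (g' u)\<^sup>2" for u
    using b by (simp_all add: D_def add_pos_nonneg)
  have Q_pos: "Q u > 0" if "u \<in> I" for u using g'_pos[OF that] D(1)[of u] by (simp add: Q_def)
  have abs: "\<bar>f u * \<kappa>\<^sub>m u\<bar> = D u" if "u \<in> I" for u
    unfolding D_def eq[OF that, symmetric] by simp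
  \<comment> \<open>A continuous function without zeros on a connected set keeps its sign.\<close>
  have "(\<forall>u\<in>I. f u * \<kappa>\<^sub>m u > 0) \<or> (\<forall>u\<in>I. f u * \<kappa>\<^sub>m u < 0)"
    by (rule connected_nonzero_sign[OF connected_I])
      (use f_nonzero \<kappa>m in \<open>auto intro!: continuous_intros continuous_on_I\<close>)
  then have "(\<forall>u\<in>I. f u * \<kappa>\<^sub>m u = D u) \<or> (\<forall>u\<in>I. f u * \<kappa>\<^sub>m u = - D u)"
  proof
    assume "\<forall>u\<in>I. f u * \<kappa>\<^sub>m u > 0"
    then have "f u * \<kappa>\<^sub>m u = D u" if "u \<in> I" for u
      using abs[OF that] that abs_of_pos by metis
    then show ?thesis by blast
  next
    assume "\<forall>u\<in>I. f u * \<kappa>\<^sub>m u < 0"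
    then have "f u * \<kappa>\<^sub>m u = - D u" if "u \<in> I" for u
      using abs[OF that] that abs_of_neg minus_minus by metis
    then show ?thesis by blast
  qed
  then have "\<exists>s::int. s \<in> {1, -1::int} \<and> (\<forall>u\<in>I. f u * \<kappa>\<^sub>m u = s * D u)"
  proof
    assume "\<forall>u\<in>I. f u * \<kappa>\<^sub>m u = D u"
    then show ?thesis by (intro exI[of _ 1]) simp
  next
    assume "\<forall>u\<in>I. f u * \<kappa>\<^sub>m u = - D u"
    then show ?thesis by (intro exI[of _ "-1"]) simp
  qed
  then obtain s :: int where "s \<in> {1, -1::int} \<and> (\<forall>u\<in>I. f u * \<kappa>\<^sub>m u = s * D u)" ..
  then have s: "s \<in> {1, -1}" and fk: "\<And>u. u \<in> I \<Longrightarrow> f u * \<kappa>\<^sub>m u = s * D u"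
    by simp_all
  define P where "P u = f u powi s" for u
  have P: "P u \<noteq> 0" if "u \<in> I" for u using f_nonzero[OF that] by (simp add: P_def)
  \<comment> \<open>\<open>Q\<close> and \<open>P\<close> have the same logarithmic derivative
    \<open>s * f' / f\<close>, so their quotient is constant.\<close>
  have "((\<lambda>u. Q u / P u) has_vector_derivative 0) (at u within I)" if u: "u \<in> I" for u
  proof -
    have dg: "(g' has_real_derivative g'' u) (at u within I)"
      using has_derivs(4)[OF u] by (simp add: has_real_derivative_iff_has_vector_derivative)
    have arg: "b\<^sup>2 + (g' u)\<^sup>2 > 0" using b by (simp add: add_pos_nonneg)
    have "(D has_real_derivative g' u * g'' u / D u) (at u within I)"
      unfolding D_def using arg by (auto intro!: derivative_eq_intros dg simp: field_simps)
    then have "(Q has_real_derivative g'' u + g' u * g'' u / D u) (at u within I)"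
      unfolding Q_def[abs_def] by (intro derivative_intros dg)
    \<comment> \<open>The left side is \<open>g'' * Q / D\<close>; substitute
      \<open>g'' = \<kappa>\<^sub>m f'\<close> and
      \<open>\<kappa>\<^sub>m = s * D / f\<close>.\<close>
    moreover have "g'' u + g' u * g'' u / D u = s * f' u * Q u / f u"
    proof -
      have \<kappa>m_eq: "\<kappa>\<^sub>m u = s * D u / f u"
        using fk[OF u] f_nonzero[OF u] by (simp add: field_simps)
      show ?thesis
        unfolding second_derivs(2)[OF u] Q_def \<kappa>m_eq
        using D(1)[of u] f_nonzero[OF u] by (simp add: field_simps)
    qed
    ultimately have dQ: "(Q has_real_derivative s * f' u * Q u / f u) (at u within I)" by simp
    have dP: "(P has_real_derivative s * f' u * P u / f u) (at u within I)"
      unfolding P_def using powi_deriv[OF u] .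
    have "((\<lambda>u. Q u / P u) has_real_derivative 0) (at u within I)"
      by (rule DERIV_cong[OF DERIV_divide[OF dQ dP P[OF u]]]) simp
    then show ?thesis by (simp add: has_real_derivative_iff_has_vector_derivative)
  qed
  then obtain k where "\<And>u. u \<in> I \<Longrightarrow> Q u / P u = k"
    using has_vector_derivative_zero_constant[OF convex_I, of "\<lambda>u. Q u / P u"] by blast
  then have Q: "Q u = k * P u" if "u \<in> I" for u
    using P[OF that] that by (metis nonzero_eq_divide_eq)
  have k: "k \<noteq> 0" using I_nonempty Q Q_pos by force
  define a where "a = k\<^sup>2"
  have a: "a \<noteq> 0" using k by (simp add: a_def)
  \<comment> \<open>The denominator of \<open>chen_y\<close> has the sign of \<open>f\<close>, so
    the leading sign has to be that of \<open>f * f'\<close>. At zeros of \<open>f'\<close> the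
    radicand vanishes and the value 1 is a convention.\<close>
  define \<epsilon> :: "real \<Rightarrow> real" where "\<epsilon> u = (if f u * f' u \<ge> 0 then 1 else -1)" for u
  have rad: "chen_radicand s a b (f u) = (2 * P u * f' u)\<^sup>2" if u: "u \<in> I" for u
  proof -
    \<comment> \<open>The conjugate of \<open>Q\<close> recovers \<open>g'\<close> from
      \<open>Q\<close> alone, as half of \<open>Q - b\<^sup>2 / Q\<close>.\<close>
    have "Q u * (D u - g' u) = b\<^sup>2"
      using D(2)[of u] by (simp add: Q_def algebra_simps power2_eq_square)
    then have "b\<^sup>2 / Q u = D u - g' u" using Q_pos[OF u] by (simp add: field_simps)
    then have "2 * g' u = Q u - b\<^sup>2 / Q u" by (simp add: Q_def)
    also have "\<dots> = k * (P u - (b\<^sup>2 / a) / P u)"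
      using k P[OF u] by (simp add: Q[OF u] a_def field_simps power2_eq_square)
    finally have "(2 * g' u)\<^sup>2 = a * (P u - (b\<^sup>2 / a) / P u)\<^sup>2"
      by (simp add: power_mult_distrib a_def)
    then have "1 - (a / 4) * (P u - (b\<^sup>2 / a) / P u)\<^sup>2 = (f' u)\<^sup>2"
      using unit_speed[OF u] by (simp add: power_mult_distrib)
    then show ?thesis
      by (simp add: chen_radicand_eq[OF f_nonzero[OF u]] P_def power_mult_distrib)
  qed
  have "f' u = chen_y (\<epsilon> u) s a b (f u)" if u: "u \<in> I" for u
  proof -
    have "\<epsilon> u * \<bar>f' u\<bar> = sgn (f u) * f' u"
      using f_nonzero[OF u]
      by (auto simp: \<epsilon>_def sgn_if abs_if zero_le_mult_iff split: if_splits)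
    moreover have "\<bar>P u\<bar> = sgn (f u) * P u"
      using sgn_powi_unit[OF s, of "f u"] by (simp add: P_def abs_sgn mult.commute)
    ultimately have "\<epsilon> u * (\<bar>P u\<bar> * \<bar>f' u\<bar>) = P u * f' u"
      using f_nonzero[OF u] by (simp add: sgn_if)
    then show ?thesis
      unfolding chen_y_def rad[OF u] P_def[symmetric] real_sqrt_abs
      using P[OF u] by (simp add: abs_mult field_simps)
  qed
  moreover have "\<epsilon> constant_on K"
    if K: "K \<subseteq> I" "is_interval K" "\<forall>u\<in>K. f' u \<noteq> 0" for K
  proof -
    \<comment> \<open>On \<open>K\<close> the product \<open>f * f'\<close> has no zeros, so its
      sign, and with it \<epsilon>, is constant.\<close>
    have "(\<forall>u\<in>K. f u * f' u > 0) \<or> (\<forall>u\<in>K. f u * f' u < 0)"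
    proof (rule connected_nonzero_sign)
      show "connected K" using K(2) by (rule is_interval_connected)
      show "continuous_on K (\<lambda>u. f u * f' u)"
        using continuous_on_I K(1) by (auto intro!: continuous_intros intro: continuous_on_subset)
    qed (use K f_nonzero in auto)
    then show ?thesis unfolding constant_on_def \<epsilon>_def by (metis less_le_not_le)
  qed
  moreover have "\<epsilon> u \<in> {1, -1}" for u by (simp add: \<epsilon>_def)
  moreover have "chen_radicand s a b (f u) \<ge> 0" if "u \<in> I" for u by (simp add: rad[OF that])
  moreover have "g' u = sqrt (1 - (f' u)\<^sup>2)" if "u \<in> I" for u
  proof -
    have "1 - (f' u)\<^sup>2 = (g' u)\<^sup>2" using unit_speed[OF that] by simp
    then show ?thesis using g'_pos[OF that] by simp
  qed
  ultimately have "meridian_determined_by_y I f g s a b"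
    unfolding meridian_determined_by_y_def by blast
  then show ?thesis using a s by blast
qed

end

section \<open>Characterization of the Chen surfaces of the general class\<close>

theorem theorem4p1:
  fixes I J :: "real set"
    and f g :: "real \<Rightarrow> real"
    and l n :: "real \<Rightarrow> real^4"
  assumes "nondegenerate_interval I" and "nondegenerate_interval J"
    and "meridian_curve I f g"
    and "arclength_spherical_curve J l" and "spherical_normal J l n"
    and "general_class I J f g l n"
    and orientation: "(\<forall>v \<in> J. spherical_curvature J l n v \<noteq> 0) \<longrightarrow>
      (\<forall>v \<in> J. spherical_curvature J l n v > 0)"
  shows "Chen_surface I J (meridian_surface f g l) \<longleftrightarrow>
    (\<exists>b > 0.
      (\<exists>C. circle_on_S2 C \<and> l ` J \<subseteq> C) \<and>
      (\<forall>v \<in> J. spherical_curvature J l n v = b) \<and>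
      (\<exists>a s. a \<noteq> 0 \<and> s \<in> {1, -1} \<and> meridian_determined_by_y I f g s a b))"
proof -
  interpret meridian I J f g l n by unfold_locales fact+
  have \<kappa>m: "\<And>u. u \<in> I \<Longrightarrow> \<kappa>\<^sub>m u \<noteq> 0" and \<kappa>_pos: "\<And>v. v \<in> J \<Longrightarrow> \<kappa> v > 0"
    using assms(6) orientation by (auto simp: general_class_def)
  show ?thesis (is "_ \<longleftrightarrow> ?R")
  proof
    assume "Chen_surface I J z"
    then have eq: "(f u * \<kappa>\<^sub>m u)\<^sup>2 = (\<kappa> v)\<^sup>2 + (g' u)\<^sup>2" if "u \<in> I" "v \<in> J" for u v
      using Chen_surface_iff[OF assms(6)] that by blast
    obtain u0 v0 where u0: "u0 \<in> I" and v0: "v0 \<in> J" using I_nonempty J_nonempty by blast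
    \<comment> \<open>Separation of variables: at the fixed parameter \<open>u0\<close> the equation
      determines the square of \<kappa>, and positivity determines \<kappa>.\<close>
    have const: "\<kappa> v = \<kappa> v0" if "v \<in> J" for v
    proof (rule power2_eq_imp_eq)
      show "(\<kappa> v)\<^sup>2 = (\<kappa> v0)\<^sup>2" using eq[OF u0 that] eq[OF u0 v0] by simp
    qed (use \<kappa>_pos[OF that] \<kappa>_pos[OF v0] in auto)
    show ?R
      using const \<kappa>_pos[OF v0] constant_curvature_imp_circle[of "\<kappa> v0"]
        curvature_eq_imp_meridian_determined[of "\<kappa> v0"] \<kappa>m eq[OF _ v0]
      by (intro exI[of _ "\<kappa> v0"]) blast
  next
    assume ?R
    then show "Chen_surface I J z"
      unfolding Chen_surface_iff[OF assms(6)]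
      using meridian_determined_imp_curvature_eq \<kappa>m by metis
  qed
qed

end
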